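(* The following two inclusions hold: $$(-\Delta)^{-1/2}L_{2,n-2}\subseteq\bigcap_{\alpha\in(0,1)}Q_\alpha\qquad\text{and}\qquad L_{2,n-2}\subseteq\bigcap_{\alpha\in(0,1)}Q_\alpha^{-1}.$$
   Context: All spaces are on $\mathbb R^n$; $B(x,r)$ is the open ball with center $x$ and radius $r$; $e^{t\Delta}$ is the heat semigroup, i.e. convolution with $(4\pi t)^{-n/2}\exp(-|x|^2/(4t))$. $L_{2,n-2}$ (square Morrey space) is the class of all $L^2_{loc}$ functions $f$ on $\mathbb R^n$ with $$\|f\|_{L_{2,n-2}}=\sup_{(r,x)\in(0,\infty)\times\mathbb R^n}\left(r^{2-n}\int_{B(x,r)}|f(y)|^2\,dy\right)^{1/2}<\infty .$$ $(-\Delta)^{-1/2}L_{2,n-2}$ is the class of all functions $f$ of the form $f(x)=\int_{\mathbb R^n}g(y)|y-x|^{1-n}\,dy$ for some $g\in L_{2,n-2}$ (the normalizing constant of the Riesz kernel is immaterial). The potential is understood modulo additive constants, i.e. $f(x)=c+\int_{\mathbb R^n}g(y)\big(|y-x|^{1-n}-|y|^{1-n}1_{\{|y|>1\}}\big)\,dy$ for a.e. $x$, with a constant $c\in\mathbb C$. For $\alpha\in(0,1)$, $Q_\alpha$ is the class of all measurable complex-valued functions $f$ on $\mathbb R^n$ with $$\sup_{(r,x)\in(0,\infty)\times\mathbb R^n}\left(r^{2\alpha-n}\iint_{B(x,r)\times B(x,r)}\frac{|f(y)-f(z)|^2}{|y-z|^{n+2\alpha}}\,dy\,dz\right)^{1/2}<\infty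 ,$$ and $Q_\alpha^{-1}$ is the class of all tempered distributions $f$ on $\mathbb R^n$ with $$\sup_{(r,x)\in(0,\infty)\times\mathbb R^n}\left(r^{2\alpha-n}\int_0^{r^2}\Big(\int_{B(x,r)}|e^{t\Delta}f(y)|^2\,dy\Big)t^{-\alpha}\,dt\right)^{1/2}<\infty .$$ *)

theory Defs
  imports "HOL-Analysis.Analysis"
begin

definition ennsqrt :: "ennreal \<Rightarrow> ennreal" where
  "ennsqrt s = (if s = top then top else ennreal (sqrt (enn2real s)))"

definition L2_loc :: "('a::euclidean_space \<Rightarrow> complex) set" where
  "L2_loc = {f \<in> borel_measurable lebesgue.
     \<forall>K. compact K \<longrightarrow> (\<integral>\<^sup>+y\<in>K. ennreal ((cmod (f y))\<^sup>2) \<partial>lebesgue) < top}"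

definition morrey_norm :: "('a::euclidean_space \<Rightarrow> complex) \<Rightarrow> ennreal" where
  "morrey_norm f = (SUP (r, x)\<in>{0::real<..} \<times> UNIV.
     ennsqrt (ennreal (r powr (2 - real DIM('a)))
       * (\<integral>\<^sup>+y\<in>ball x r. ennreal ((cmod (f y))\<^sup>2) \<partial>lebesgue)))"

definition morrey :: "('a::euclidean_space \<Rightarrow> complex) set" where
  "morrey = {f \<in> L2_loc. morrey_norm f < top}"

text \<open>Riesz potentials of order one of functions in \<^const>\<open>morrey\<close>, modulo constants.
  Subtracting \<open>|y|\<^sup>1\<^sup>-\<^sup>n\<close> outside the unit ball makes the integral converge
  absolutely for almost every \<open>x\<close>, for every \<open>g\<close> in \<^const>\<open>morrey\<close>; the unsubtracted
  integral may diverge at infinity.\<close>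

definition riesz_potential_morrey :: "('a::euclidean_space \<Rightarrow> complex) set" where
  "riesz_potential_morrey = {f. \<exists>g\<in>morrey. \<exists>c. AE x in lebesgue.
     f x = c + (\<integral>y. g y * complex_of_real
        (norm (y - x) powr (1 - real DIM('a))
          - norm y powr (1 - real DIM('a)) * indicator {y. 1 < norm y} y) \<partial>lebesgue)}"

definition Q_seminorm :: "real \<Rightarrow> ('a::euclidean_space \<Rightarrow> complex) \<Rightarrow> ennreal" where
  "Q_seminorm \<alpha> f = (SUP (r, x)\<in>{0::real<..} \<times> UNIV.
     ennsqrt (ennreal (r powr (2 * \<alpha> - real DIM('a)))
       * (\<integral>\<^sup>+p\<in>ball x r \<times> ball x r.
           ennreal ((cmod (f (fst p) - f (snd p)))\<^sup>2
             / norm (fst p - snd p) powr (real DIM('a) + 2 * \<alpha>))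
           \<partial>(lebesgue \<Otimes>\<^sub>M lebesgue))))"

definition Q_space :: "real \<Rightarrow> ('a::euclidean_space \<Rightarrow> complex) set" where
  "Q_space \<alpha> = {f \<in> borel_measurable lebesgue. Q_seminorm \<alpha> f < top}"

text \<open>Iterated partial derivatives, along a list of basis vectors.\<close>

primrec partials :: "'a::euclidean_space list \<Rightarrow> ('a \<Rightarrow> complex) \<Rightarrow> 'a \<Rightarrow> complex" where
  "partials [] \<phi> = \<phi>"
| "partials (b # bs) \<phi> = (\<lambda>x. frechet_derivative (partials bs \<phi>) (at x) b)"

definition schwartz :: "('a::euclidean_space \<Rightarrow> complex) set" where
  "schwartz = {\<phi>. \<forall>bs\<in>lists Basis. (\<forall>x. partials bs \<phi> differentiable (at x)) \<and>
     (\<forall>N::nat. bdd_above (range (\<lambda>x. (1 + norm x) ^ N * cmod (partials bs \<phi> x))))}"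

definition schwartz_norm :: "nat \<Rightarrow> ('a::euclidean_space \<Rightarrow> complex) \<Rightarrow> real" where
  "schwartz_norm N \<phi> = (\<Sum>bs\<in>{bs \<in> lists Basis. length bs \<le> N}.
     (SUP x. (1 + norm x) ^ N * cmod (partials bs \<phi> x)))"

text \<open>A tempered distribution is a complex-linear functional on the Schwartz space that is
  continuous for the topology generated by the increasing family \<^const>\<open>schwartz_norm\<close>.
  Its values on functions outside \<^const>\<open>schwartz\<close> are arbitrary and never used.\<close>

definition tempered_distributions ::
    "(('a::euclidean_space \<Rightarrow> complex) \<Rightarrow> complex) set" where
  "tempered_distributions = {u.
     (\<forall>\<phi>\<in>schwartz. \<forall>\<psi>\<in>schwartz. u (\<lambda>x. \<phi> x + \<psi> x) = u \<phi> + u \<psi>) \<and>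
     (\<forall>c. \<forall>\<phi>\<in>schwartz. u (\<lambda>x. c * \<phi> x) = c * u \<phi>) \<and>
     (\<exists>C N. \<forall>\<phi>\<in>schwartz. cmod (u \<phi>) \<le> C * schwartz_norm N \<phi>)}"

definition represented_by ::
    "(('a::euclidean_space \<Rightarrow> complex) \<Rightarrow> complex) \<Rightarrow> ('a \<Rightarrow> complex) \<Rightarrow> bool" where
  "represented_by u f \<longleftrightarrow> (\<forall>\<phi>\<in>schwartz.
     integrable lebesgue (\<lambda>x. f x * \<phi> x) \<and> u \<phi> = (\<integral>x. f x * \<phi> x \<partial>lebesgue))"

definition heat_kernel :: "real \<Rightarrow> 'a::euclidean_space \<Rightarrow> real" where
  "heat_kernel t x = (4 * pi * t) powr (- real DIM('a) / 2) * exp (- (norm x)\<^sup>2 / (4 * t))"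

text \<open>The convolution of a tempered distribution with the heat kernel, as a function.\<close>

definition heat_semigroup ::
    "real \<Rightarrow> (('a::euclidean_space \<Rightarrow> complex) \<Rightarrow> complex) \<Rightarrow> 'a \<Rightarrow> complex" where
  "heat_semigroup t u x = u (\<lambda>y. complex_of_real (heat_kernel t (x - y)))"

definition Q_inv_norm ::
    "real \<Rightarrow> (('a::euclidean_space \<Rightarrow> complex) \<Rightarrow> complex) \<Rightarrow> ennreal" where
  "Q_inv_norm \<alpha> u = (SUP (r, x)\<in>{0::real<..} \<times> UNIV.
     ennsqrt (ennreal (r powr (2 * \<alpha> - real DIM('a)))
       * (\<integral>\<^sup>+t\<in>{0<..<r\<^sup>2}.
           (\<integral>\<^sup>+y\<in>ball x r. ennreal ((cmod (heat_semigroup t u y))\<^sup>2) \<partial>lebesgue)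
             * ennreal (t powr (- \<alpha>)) \<partial>lebesgue)))"

definition Q_inv :: "real \<Rightarrow> (('a::euclidean_space \<Rightarrow> complex) \<Rightarrow> complex) set" where
  "Q_inv \<alpha> = {u \<in> tempered_distributions. Q_inv_norm \<alpha> u < top}"

end

theory Submission
  imports Defs
begin

text \<open>Write \<open>n\<close> for the dimension, let \<open>g\<close> be a function in the square Morrey space and \<open>a = |g|\<close>.
  The whole proof rests on the growth condition \<open>\<integral>\<^sub>B a\<^sup>2 \<le> A s\<^sup>n\<^sup>-\<^sup>2\<close> on balls \<open>B\<close> of radius
  \<open>s\<close>, on dyadic shells and on the Cauchy-Schwarz inequality.

  The common engine is \<open>morrey_kernel_bound\<close>, an estimate in the square mean over a ball
  \<open>B(x, r)\<close> of \<open>y \<mapsto> \<integral> a(w) k(|y - w|) dw\<close> for a kernel \<open>k\<close> of which two things are known: its mass in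
  the ball of radius \<open>r\<close>, and a bound \<open>k(t) \<le> D t\<^sup>1\<^sup>-\<^sup>n\<^sup>-\<^sup>\<beta>\<close> for \<open>t \<ge> r\<close> with some \<open>\<beta> > 0\<close>. The part \<open>|y - w| < r\<close>
  only sees \<open>a\<close> on \<open>B(x, 2r)\<close> and is handled by Schur's test (\<open>schur_test_ball\<close>); the part
  \<open>|y - w| \<ge> r\<close> is even bounded pointwise (\<open>far_cauchy_schwarz\<close>), because over the shell of radius
  \<open>2\<^sup>kr\<close> the integral of \<open>a(w)|y - w|\<^sup>1\<^sup>-\<^sup>n\<^sup>-\<^sup>\<beta>\<close> is of size \<open>(2\<^sup>kr)\<^sup>-\<^sup>\<beta>\<close>, which is summable in \<open>k\<close>.

  For the first inclusion, fix \<open>\<alpha> < \<beta> < 1\<close>. The elementary inequality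
  \<open>|u\<^sup>1\<^sup>-\<^sup>n - v\<^sup>1\<^sup>-\<^sup>n| \<le> (n - 1)|u - v|\<^sup>\<beta>(u\<^sup>1\<^sup>-\<^sup>n\<^sup>-\<^sup>\<beta> + v\<^sup>1\<^sup>-\<^sup>n\<^sup>-\<^sup>\<beta>)\<close> shows that the Riesz potential \<open>f\<close> of \<open>g\<close> satisfies
  \<open>|f(y) - f(z)| \<le> n|y - z|\<^sup>\<beta>(I(y) + I(z))\<close> for almost all \<open>y\<close> and \<open>z\<close>, where \<open>I\<close> is the fractional potential of \<open>a\<close> with
  kernel \<open>t\<^sup>1\<^sup>-\<^sup>n\<^sup>-\<^sup>\<beta>\<close> (\<open>riesz_potential_difference\<close>). The engine gives \<open>\<integral>\<^sub>B I\<^sup>2 \<le> C r\<^sup>n\<^sup>-\<^sup>2\<^sup>\<beta>\<close>. Since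
  \<open>|y - z|\<^sup>2\<^sup>\<beta>\<^sup>-\<^sup>2\<^sup>\<alpha>\<^sup>-\<^sup>n\<close> has integral of order \<open>r\<^sup>2\<^sup>\<beta>\<^sup>-\<^sup>2\<^sup>\<alpha>\<close> in \<open>z\<close> over \<open>B\<close>, the double integral in the definition
  of \<open>Q\<^sub>\<alpha>\<close> is at most of order \<open>r\<^sup>n\<^sup>-\<^sup>2\<^sup>\<alpha>\<close> (\<open>Q_seminorm_finite\<close>).

  For the second inclusion, the heat kernel at time \<open>t \<le> r\<^sup>2\<close> has bounded mass and is at most a multiple of
  \<open>\<surd>t |z|\<^sup>-\<^sup>n\<^sup>-\<^sup>1 \<le> r |z|\<^sup>-\<^sup>n\<^sup>-\<^sup>1\<close>, so the engine with \<open>\<beta> = 2\<close> bounds the heat extension on \<open>B(x, r)\<close> by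
  \<open>C r\<^sup>n\<^sup>-\<^sup>2\<close> in the square mean, uniformly in \<open>t\<close> (\<open>heat_extension_bound\<close>). Integrating \<open>t\<^sup>-\<^sup>\<alpha>\<close> over \<open>(0, r\<^sup>2)\<close>
  contributes \<open>r\<^sup>2\<^sup>-\<^sup>2\<^sup>\<alpha>\<close>. That \<open>g\<close> is a tempered distribution follows from
  \<open>\<integral> a(w)(1 + |w|)\<^sup>-\<^sup>n dw < \<infinity>\<close> (\<open>morrey_tempered\<close>).\<close>

section \<open>Measures of polynomial growth on balls\<close>
definition ball_growth :: "('a::euclidean_space \<Rightarrow> ennreal) \<Rightarrow> ennreal \<Rightarrow> real \<Rightarrow> bool" where
  "ball_growth G A p \<longleftrightarrow>
     (\<forall>y. \<forall>s>0. (\<integral>\<^sup>+w. G w * indicator (ball y s) w \<partial>lborel) \<le> A * ennreal (s powr p))"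

lemma measurable_in_ball [measurable (raw)]:
  fixes f g :: "'b \<Rightarrow> 'a::euclidean_space"
  assumes [measurable]: "f \<in> borel_measurable M" "g \<in> borel_measurable M"
  shows "Measurable.pred M (\<lambda>x. g x \<in> ball (f x) r)"
  unfolding mem_ball by measurable

text \<open>On the shell \<open>s k \<le> dist y w < 2 s k\<close> the power \<open>dist y w powr q\<close> is comparable to \<open>s k powr q\<close>, and
  the mass of the shell is at most \<open>A (2 s k) powr p\<close>. The factor \<open>2 powr \<bar>q\<bar>\<close> serves both signs of \<open>q\<close>. The
  centre \<open>y\<close> may be left uncovered because \<open>0 powr q = 0\<close>.\<close>
lemma dyadic_shells_integral:
  fixes G :: "'a::euclidean_space \<Rightarrow> ennreal" and s :: "nat \<Rightarrow> real"
  assumes [measurable]: "G \<in> borel_measurable borel"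
    and growth: "ball_growth G A p"
    and s: "\<And>k. 0 < s k"
    and cover: "\<And>w. w \<in> S \<Longrightarrow> w \<noteq> y \<Longrightarrow> \<exists>k. s k \<le> dist y w \<and> dist y w < 2 * s k"
  shows "(\<integral>\<^sup>+w. G w * ennreal (dist y w powr q) * indicator S w \<partial>lborel)
         \<le> A * (\<Sum>k. ennreal (2 powr (\<bar>q\<bar> + p) * s k powr (q + p)))"
proof -
  define T where "T k w = ennreal (2 powr \<bar>q\<bar> * s k powr q) * (G w * indicator (ball y (2 * s k)) w)"
    for k w
  have [measurable]: "T k \<in> borel_measurable borel" for k
    unfolding T_def[abs_def]
    by measurable
  have pw: "G w * ennreal (dist y w powr q) * indicator S w \<le> (\<Sum>k. T k w)" for w
  proof (cases "w \<in> S \<and> w \<noteq> y")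
    case True
    then obtain k where k: "s k \<le> dist y w" "dist y w < 2 * s k"
      using cover by blast
    have "dist y w powr q \<le> 2 powr \<bar>q\<bar> * s k powr q"
    proof (cases "q \<ge> 0")
      case True
      have "dist y w powr q \<le> (2 * s k) powr q"
        using k s[of k] True by (intro powr_mono2) auto
      then show ?thesis using True s[of k] by (simp add: powr_mult)
    next
      case False
      have "dist y w powr q \<le> s k powr q"
        using k s[of k] False by (intro powr_mono2') auto
      also have "\<dots> \<le> 2 powr \<bar>q\<bar> * s k powr q"
        using mult_right_mono[OF ge_one_powr_ge_zero[of 2 "\<bar>q\<bar>"], of "s k powr q"] by simp
      finally show ?thesis .
    qed
    then have "G w * ennreal (dist y w powr q) * indicator S w \<le> G w * ennreal (2 powr \<bar>q\<bar> * s k powr q)"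
      using True by (auto intro!: mult_left_mono ennreal_leI)
    also have "\<dots> = T k w"
      using k by (simp add: T_def mult.commute)
    also have "\<dots> \<le> (\<Sum>k. T k w)"
      using sum_le_suminf[of "\<lambda>k. T k w" "{k}"] by simp
    finally show ?thesis .
  qed auto
  have "(\<integral>\<^sup>+w. T k w \<partial>lborel) \<le> A * ennreal (2 powr (\<bar>q\<bar> + p) * s k powr (q + p))" for k
  proof -
    have "(\<integral>\<^sup>+w. T k w \<partial>lborel) =
        ennreal (2 powr \<bar>q\<bar> * s k powr q) * (\<integral>\<^sup>+w. G w * indicator (ball y (2 * s k)) w \<partial>lborel)"
      unfolding T_def by (rule nn_integral_cmult) measurable
    also have "\<dots> \<le> ennreal (2 powr \<bar>q\<bar> * s k powr q) * (A * ennreal ((2 * s k) powr p))"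
      using growth s[of k] by (intro mult_left_mono) (auto simp: ball_growth_def)
    also have "\<dots> = A * ennreal (2 powr \<bar>q\<bar> * s k powr q * (2 * s k) powr p)"
      by (simp add: ennreal_mult mult_ac)
    also have "2 powr \<bar>q\<bar> * s k powr q * (2 * s k) powr p = 2 powr (\<bar>q\<bar> + p) * s k powr (q + p)"
      using s[of k] by (simp add: powr_mult powr_add mult_ac)
    finally show ?thesis .
  qed
  then have "(\<Sum>k. \<integral>\<^sup>+w. T k w \<partial>lborel)
      \<le> (\<Sum>k. A * ennreal (2 powr (\<bar>q\<bar> + p) * s k powr (q + p)))"
    by (intro suminf_le) simp_all
  moreover have "(\<integral>\<^sup>+w. (\<Sum>k. T k w) \<partial>lborel) = (\<Sum>k. \<integral>\<^sup>+w. T k w \<partial>lborel)"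
    by (rule nn_integral_suminf) simp
  moreover have "(\<integral>\<^sup>+w. G w * ennreal (dist y w powr q) * indicator S w \<partial>lborel)
      \<le> (\<integral>\<^sup>+w. (\<Sum>k. T k w) \<partial>lborel)"
    by (intro nn_integral_mono pw)
  ultimately show ?thesis by simp
qed

lemma ex_dyadic_scale:
  fixes r t :: real
  assumes "0 < r" "r \<le> t"
  shows "\<exists>k. r * 2 ^ k \<le> t \<and> t < 2 * (r * 2 ^ k)"
proof -
  define n where "n = (LEAST n. t < r * 2 ^ n)"
  have "\<exists>n. t < r * 2 ^ n"
    using real_arch_pow[of 2 "t / r"] assms by (auto simp: field_simps)
  then have n: "t < r * 2 ^ n" unfolding n_def by (rule LeastI_ex)
  with assms have "n \<noteq> 0" by (intro notI) simp
  then obtain k where k: "n = Suc k" by (cases n) auto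
  have "\<not> t < r * 2 ^ k"
    using not_less_Least[of k "\<lambda>n. t < r * 2 ^ n"] k by (simp add: n_def)
  then show ?thesis using n k by (auto intro!: exI[of _ k])
qed

lemma suminf_geometric_powr:
  fixes \<gamma> b :: real
  assumes "0 < \<gamma>" "0 \<le> b"
  shows "(\<Sum>k. ennreal (b * (2 powr - \<gamma>) ^ k)) = ennreal (b / (1 - 2 powr - \<gamma>))"
proof (rule suminf_ennreal_eq)
  have "(2::real) powr - \<gamma> < 1" using assms by (simp add: powr_minus_divide)
  then show "(\<lambda>k. b * (2 powr - \<gamma>) ^ k) sums (b / (1 - 2 powr - \<gamma>))"
    using sums_mult[OF geometric_sums[of "(2::real) powr - \<gamma>"], of b] by simp
qed (use assms in auto)

lemma power_powr: "(2 ^ k) powr a = (2 powr a) ^ k" for a :: real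
  by (induction k) (simp_all add: powr_mult)

text \<open>Shells of radius \<open>2\<^sup>kr\<close> contribute \<open>(2\<^sup>kr)\<^sup>-\<^sup>\<gamma>\<close> each. The constant depends on the dimension and the exponents only,
  so that it can be reused for all densities, centres and radii.\<close>
lemma far_integral:
  assumes "0 < \<gamma>"
  obtains C where "0 \<le> C"
    "\<And>(G :: 'a::euclidean_space \<Rightarrow> ennreal) A y r. \<lbrakk>G \<in> borel_measurable borel; ball_growth G A p; 0 < r\<rbrakk> \<Longrightarrow>
      (\<integral>\<^sup>+w. G w * ennreal (dist y w powr (- p - \<gamma>)) * indicator (- ball y r) w \<partial>lborel)
        \<le> A * ennreal (C * r powr - \<gamma>)"
proof -
  define C where "C = 2 powr (\<bar>- p - \<gamma>\<bar> + p) / (1 - 2 powr - \<gamma>)"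
  have "(2::real) powr - \<gamma> < 1" using assms by (simp add: powr_minus_divide)
  then have "0 \<le> C" by (simp add: C_def)
  moreover have "(\<integral>\<^sup>+w. G w * ennreal (dist y w powr (- p - \<gamma>)) * indicator (- ball y r) w \<partial>lborel)
        \<le> A * ennreal (C * r powr - \<gamma>)"
    if G: "G \<in> borel_measurable borel" "ball_growth G A p" and r: "0 < r"
    for G :: "'a \<Rightarrow> ennreal" and A y r
  proof -
    have "(r * 2 ^ k) powr - \<gamma> = r powr - \<gamma> * (2 powr - \<gamma>) ^ k" for k
      using r by (simp only: powr_mult power_powr)
    then have eq: "(\<Sum>k. ennreal (2 powr (\<bar>- p - \<gamma>\<bar> + p) * (r * 2 ^ k) powr ((- p - \<gamma>) + p)))
        = ennreal (C * r powr - \<gamma>)"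
      using suminf_geometric_powr[OF assms, of "2 powr (\<bar>- p - \<gamma>\<bar> + p) * r powr - \<gamma>"]
      by (simp only: C_def mult.assoc times_divide_eq_left diff_add_eq diff_add_cancel
            add.left_inverse diff_0 minus_add_cancel mult_nonneg_nonneg powr_ge_zero)
    have "(\<integral>\<^sup>+w. G w * ennreal (dist y w powr (- p - \<gamma>)) * indicator (- ball y r) w \<partial>lborel)
      \<le> A * (\<Sum>k. ennreal (2 powr (\<bar>- p - \<gamma>\<bar> + p) * (r * 2 ^ k) powr ((- p - \<gamma>) + p)))"
      using G r by (intro dyadic_shells_integral) (auto intro!: ex_dyadic_scale)
    then show ?thesis unfolding eq .
  qed
  ultimately show ?thesis by (rule that)
qed

text \<open>The counterpart of \<open>far_integral\<close> inside the ball: the shells now shrink to the centre, and the surplus \<open>\<gamma>\<close> in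
  the exponent makes their contributions \<open>(2\<^sup>-\<^sup>kr)\<^sup>\<gamma>\<close> summable.\<close>
lemma near_integral:
  assumes "0 < \<gamma>"
  obtains C where "0 \<le> C"
    "\<And>(G :: 'a::euclidean_space \<Rightarrow> ennreal) A y r. \<lbrakk>G \<in> borel_measurable borel; ball_growth G A p; 0 < r\<rbrakk> \<Longrightarrow>
      (\<integral>\<^sup>+w. G w * ennreal (dist y w powr (- p + \<gamma>)) * indicator (ball y r) w \<partial>lborel)
        \<le> A * ennreal (C * r powr \<gamma>)"
proof -
  define C where "C = 2 powr (\<bar>- p + \<gamma>\<bar> + p) / (1 - 2 powr - \<gamma>)"
  have "(2::real) powr - \<gamma> < 1" using assms by (simp add: powr_minus_divide)
  then have C: "0 \<le> C" by (simp add: C_def)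
  moreover have "(\<integral>\<^sup>+w. G w * ennreal (dist y w powr (- p + \<gamma>)) * indicator (ball y r) w \<partial>lborel)
        \<le> A * ennreal (C * r powr \<gamma>)"
    if G: "G \<in> borel_measurable borel" "ball_growth G A p" and r: "0 < r"
    for G :: "'a \<Rightarrow> ennreal" and A y r
  proof -
    have shell: "\<exists>k. r / 2 ^ k \<le> dist y w \<and> dist y w < 2 * (r / 2 ^ k)" if w: "w \<in> ball y r" "w \<noteq> y" for w
    proof -
      \<comment> \<open>The largest dyadic radius not exceeding the distance.\<close>
      define n where "n = (LEAST n. r / 2 ^ n \<le> dist y w)"
      have "\<exists>n. r / 2 ^ n \<le> dist y w"
        using real_arch_pow[of 2 "r / dist y w"] w by (auto simp: field_simps intro: less_imp_le)
      then have n: "r / 2 ^ n \<le> dist y w" unfolding n_def by (rule LeastI_ex)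
      have "dist y w < 2 * (r / 2 ^ n)"
      proof (cases n)
        case 0
        then show ?thesis using w r by simp
      next
        case (Suc k)
        then have "\<not> r / 2 ^ k \<le> dist y w"
          using not_less_Least[of k "\<lambda>n. r / 2 ^ n \<le> dist y w"] by (simp add: n_def)
        then show ?thesis using Suc by simp
      qed
      then show ?thesis using n by blast
    qed
    have "(r / 2 ^ k) powr \<gamma> = r powr \<gamma> * (2 powr - \<gamma>) ^ k" for k
      using r by (simp add: powr_divide power_powr powr_minus_divide power_one_over field_simps)
    then have eq: "(\<Sum>k. ennreal (2 powr (\<bar>- p + \<gamma>\<bar> + p) * (r / 2 ^ k) powr ((- p + \<gamma>) + p)))
        = ennreal (C * r powr \<gamma>)"
      using suminf_geometric_powr[OF assms, of "2 powr (\<bar>- p + \<gamma>\<bar> + p) * r powr \<gamma>"]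
      by (simp only: C_def mult.assoc times_divide_eq_left add.commute[of "- p" \<gamma>] diff_add_cancel
            uminus_add_conv_diff diff_add_cancel mult_nonneg_nonneg powr_ge_zero)
    have "(\<integral>\<^sup>+w. G w * ennreal (dist y w powr (- p + \<gamma>)) * indicator (ball y r) w \<partial>lborel)
      \<le> A * (\<Sum>k. ennreal (2 powr (\<bar>- p + \<gamma>\<bar> + p) * (r / 2 ^ k) powr ((- p + \<gamma>) + p)))"
      using G r shell by (intro dyadic_shells_integral) auto
    then show ?thesis unfolding eq .
  qed
  ultimately show ?thesis by (rule that)
qed

lemma ball_growth_lebesgue:
  "ball_growth (\<lambda>_::'a::euclidean_space. 1) (ennreal (unit_ball_vol (real DIM('a)))) (real DIM('a))"
  unfolding ball_growth_def
  by (auto simp: emeasure_ball ennreal_mult powr_realpow)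

section \<open>Integral operators on the square Morrey space\<close>
lemma powr_half_square: "(x powr (e / 2))\<^sup>2 = x powr e" for x :: real
  by (simp add: power2_eq_square powr_add[symmetric])

lemma ennreal_add_square_le: "(x + y)\<^sup>2 \<le> 4 * (x\<^sup>2 + y\<^sup>2)" for x y :: ennreal
proof -
  have "(x + y)\<^sup>2 \<le> (2 * max x y)\<^sup>2"
    by (intro power_mono) (auto simp: mult_2 max_def intro: add_mono)
  also have "\<dots> = 4 * (max x y)\<^sup>2"
    by (simp add: power_mult_distrib)
  also have "\<dots> \<le> 4 * (x\<^sup>2 + y\<^sup>2)"
    by (intro mult_left_mono) (auto simp: max_def)
  finally show ?thesis .
qed

text \<open>The exponent splits as half of \<open>- (n - 2) - \<beta>\<close>, just integrable at infinity against a density of growth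
  \<open>n - 2\<close>, plus half of \<open>- n - \<beta>\<close>, just integrable against Lebesgue measure. After the Cauchy-Schwarz inequality
  \<open>far_integral\<close> applies to both factors.\<close>
lemma far_cauchy_schwarz:
  assumes "0 < \<beta>"
  obtains C where "0 \<le> C"
    "\<And>(a :: 'a::euclidean_space \<Rightarrow> ennreal) A y r.
      \<lbrakk>a \<in> borel_measurable borel; ball_growth (\<lambda>w. (a w)\<^sup>2) A (real DIM('a) - 2); 0 < r\<rbrakk> \<Longrightarrow>
      (\<integral>\<^sup>+w. a w * ennreal (dist y w powr (1 - real DIM('a) - \<beta>)) * indicator (- ball y r) w \<partial>lborel)\<^sup>2
        \<le> A * ennreal (C * r powr (- 2 * \<beta>))"
proof -
  define n where "n = real DIM('a)"
  define V where "V = unit_ball_vol n"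
  have V: "0 \<le> V" by (simp add: V_def n_def)
  obtain C1 where C1: "0 \<le> C1"
    "\<And>(G :: 'a \<Rightarrow> ennreal) A y r. \<lbrakk>G \<in> borel_measurable borel; ball_growth G A (n - 2); 0 < r\<rbrakk> \<Longrightarrow>
      (\<integral>\<^sup>+w. G w * ennreal (dist y w powr (- (n - 2) - \<beta>)) * indicator (- ball y r) w \<partial>lborel)
        \<le> A * ennreal (C1 * r powr - \<beta>)"
    using far_integral[OF assms] by blast
  obtain C2 where C2: "0 \<le> C2"
    "\<And>(G :: 'a \<Rightarrow> ennreal) A y r. \<lbrakk>G \<in> borel_measurable borel; ball_growth G A n; 0 < r\<rbrakk> \<Longrightarrow>
      (\<integral>\<^sup>+w. G w * ennreal (dist y w powr (- n - \<beta>)) * indicator (- ball y r) w \<partial>lborel)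
        \<le> A * ennreal (C2 * r powr - \<beta>)"
    using far_integral[OF assms] by blast
  show ?thesis
  proof (rule that)
    show "0 \<le> C1 * V * C2" using C1(1) C2(1) V by simp
    fix a :: "'a \<Rightarrow> ennreal" and A y and r :: real
    assume a[measurable]: "a \<in> borel_measurable borel"
      and growth: "ball_growth (\<lambda>w. (a w)\<^sup>2) A (real DIM('a) - 2)" and r: "0 < r"
    let ?f = "\<lambda>w. a w * ennreal (dist y w powr ((- (n - 2) - \<beta>) / 2)) * indicator (- ball y r) w"
    let ?g = "\<lambda>w. ennreal (dist y w powr ((- n - \<beta>) / 2)) * indicator (- ball y r) w"
    have "a w * ennreal (dist y w powr (1 - n - \<beta>)) * indicator (- ball y r) w = ?f w * ?g w" for w
    proof -
      have "1 - n - \<beta> = (- (n - 2) - \<beta>) / 2 + (- n - \<beta>) / 2" by (simp add: field_simps)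
      then have "dist y w powr (1 - n - \<beta>)
          = dist y w powr ((- (n - 2) - \<beta>) / 2) * dist y w powr ((- n - \<beta>) / 2)"
        by (simp only: powr_add)
      then show ?thesis by (simp add: ennreal_mult mult_ac split: split_indicator)
    qed
    then have "(\<integral>\<^sup>+w. a w * ennreal (dist y w powr (1 - n - \<beta>)) * indicator (- ball y r) w \<partial>lborel)\<^sup>2
        = (\<integral>\<^sup>+w. ?f w * ?g w \<partial>lborel)\<^sup>2"
      by simp
    also have "\<dots> \<le> (\<integral>\<^sup>+w. ?f w ^ 2 \<partial>lborel) * (\<integral>\<^sup>+w. ?g w ^ 2 \<partial>lborel)"
      by (rule Cauchy_Schwarz_nn_integral) measurable
    also have "(\<integral>\<^sup>+w. ?f w ^ 2 \<partial>lborel)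
        = (\<integral>\<^sup>+w. (a w)\<^sup>2 * ennreal (dist y w powr (- (n - 2) - \<beta>)) * indicator (- ball y r) w \<partial>lborel)"
      by (intro nn_integral_cong)
        (simp add: power_mult_distrib ennreal_power powr_half_square split: split_indicator)
    also have "(\<integral>\<^sup>+w. ?g w ^ 2 \<partial>lborel)
        = (\<integral>\<^sup>+w. 1 * ennreal (dist y w powr (- n - \<beta>)) * indicator (- ball y r) w \<partial>lborel)"
      by (intro nn_integral_cong)
        (simp add: power_mult_distrib ennreal_power powr_half_square split: split_indicator)
    also have "(\<integral>\<^sup>+w. (a w)\<^sup>2 * ennreal (dist y w powr (- (n - 2) - \<beta>)) * indicator (- ball y r) w \<partial>lborel)
        * (\<integral>\<^sup>+w. 1 * ennreal (dist y w powr (- n - \<beta>)) * indicator (- ball y r) w \<partial>lborel)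
        \<le> (A * ennreal (C1 * r powr - \<beta>)) * (ennreal V * ennreal (C2 * r powr - \<beta>))"
      using growth ball_growth_lebesgue[where 'a='a] r
      by (intro mult_mono C1(2) C2(2)) (auto simp: n_def V_def)
    also have "\<dots> = A * ennreal (C1 * V * C2 * r powr (- 2 * \<beta>))"
    proof -
      have "r powr (- 2 * \<beta>) = r powr - \<beta> * r powr - \<beta>" by (simp add: powr_add[symmetric])
      then have "C1 * V * C2 * r powr (- 2 * \<beta>) = (C1 * r powr - \<beta>) * (V * (C2 * r powr - \<beta>))"
        by (simp only: mult_ac)
      then show ?thesis using C1(1) C2(1) V by (simp only: ennreal_mult mult_nonneg_nonneg powr_ge_zero mult.assoc)
    qed
    finally show "(\<integral>\<^sup>+w. a w * ennreal (dist y w powr (1 - real DIM('a) - \<beta>)) * indicator (- ball y r) w \<partial>lborel)\<^sup>2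
        \<le> A * ennreal (C1 * V * C2 * r powr (- 2 * \<beta>))"
      unfolding n_def .
  qed
qed

text \<open>Schur's test for the symmetric kernel \<open>k (dist y w)\<close> cut off at distance \<open>r\<close>: by Cauchy-Schwarz with \<open>\<surd>k \<cdot> \<surd>k\<close> the
  inner square is at most \<open>K \<integral> a\<^sup>2 k\<close>, and integrating in \<open>y\<close> first costs \<open>K\<close> once more. The cut-off keeps \<open>w\<close> in the
  ball of twice the radius.\<close>
lemma schur_test_ball:
  fixes a :: "'a::euclidean_space \<Rightarrow> ennreal" and k :: "real \<Rightarrow> real"
  assumes [measurable]: "a \<in> borel_measurable borel" "k \<in> borel_measurable borel"
    and k: "\<And>t. 0 \<le> k t"
    and K: "\<And>y::'a. (\<integral>\<^sup>+w. ennreal (k (dist y w)) * indicator (ball y r) w \<partial>lborel) \<le> K"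
  shows "(\<integral>\<^sup>+y. (\<integral>\<^sup>+w. a w * ennreal (k (dist y w)) * indicator (ball y r) w \<partial>lborel)\<^sup>2
            * indicator (ball x r) y \<partial>lborel)
         \<le> K\<^sup>2 * (\<integral>\<^sup>+w. (a w)\<^sup>2 * indicator (ball x (2 * r)) w \<partial>lborel)"
proof -
  let ?k = "\<lambda>y w. ennreal (k (dist y w)) * indicator (ball y r) w"
  let ?s = "\<lambda>y w. ennreal (sqrt (k (dist y w))) * indicator (ball y r) w"
  let ?I = "\<lambda>w. indicator (ball x (2 * r)) w :: ennreal"
  have sq: "(?s y w)\<^sup>2 = ?k y w" for y w
    using k by (simp add: power_mult_distrib ennreal_power split: split_indicator)
  have cs: "(\<integral>\<^sup>+w. a w * ennreal (k (dist y w)) * indicator (ball y r) w \<partial>lborel)\<^sup>2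
      \<le> (\<integral>\<^sup>+w. (a w)\<^sup>2 * ?k y w \<partial>lborel) * K" for y
  proof -
    have "(\<integral>\<^sup>+w. a w * ennreal (k (dist y w)) * indicator (ball y r) w \<partial>lborel)
        = (\<integral>\<^sup>+w. (a w * ?s y w) * ?s y w \<partial>lborel)"
      by (intro nn_integral_cong) (simp only: mult.assoc sq[unfolded power2_eq_square, symmetric])
    then have "(\<integral>\<^sup>+w. a w * ennreal (k (dist y w)) * indicator (ball y r) w \<partial>lborel)\<^sup>2
        \<le> (\<integral>\<^sup>+w. (a w * ?s y w)\<^sup>2 \<partial>lborel) * (\<integral>\<^sup>+w. (?s y w)\<^sup>2 \<partial>lborel)"
      by (simp only:) (rule Cauchy_Schwarz_nn_integral; measurable)
    also have "\<dots> = (\<integral>\<^sup>+w. (a w)\<^sup>2 * ?k y w \<partial>lborel) * (\<integral>\<^sup>+w. ?k y w \<partial>lborel)"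
      by (simp only: power_mult_distrib[of "a _"] sq)
    also have "\<dots> \<le> (\<integral>\<^sup>+w. (a w)\<^sup>2 * ?k y w \<partial>lborel) * K"
      by (intro mult_left_mono K) simp
    finally show ?thesis .
  qed
  have "(\<integral>\<^sup>+y. (\<integral>\<^sup>+w. a w * ennreal (k (dist y w)) * indicator (ball y r) w \<partial>lborel)\<^sup>2
            * indicator (ball x r) y \<partial>lborel)
      \<le> (\<integral>\<^sup>+y. (\<integral>\<^sup>+w. (a w)\<^sup>2 * ?k y w \<partial>lborel) * K * indicator (ball x r) y \<partial>lborel)"
    by (intro nn_integral_mono mult_right_mono cs) simp
  also have "\<dots> = (\<integral>\<^sup>+y. \<integral>\<^sup>+w. K * ((a w)\<^sup>2 * ?k y w * indicator (ball x r) y) \<partial>lborel \<partial>lborel)"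
    by (intro nn_integral_cong)
      (simp add: nn_integral_multc nn_integral_cmult mult_ac split: split_indicator)
  also have "\<dots> \<le> (\<integral>\<^sup>+y. \<integral>\<^sup>+w. K * ((a w)\<^sup>2 * ?I w * ?k w y) \<partial>lborel \<partial>lborel)"
  proof (intro nn_integral_mono mult_left_mono)
    fix y w
    have "dist x w < 2 * r" if "dist x y < r" "dist y w < r"
      using that dist_triangle[of x w y] by linarith
    then show "(a w)\<^sup>2 * ?k y w * indicator (ball x r) y \<le> (a w)\<^sup>2 * ?I w * ?k w y"
      by (auto simp: indicator_def dist_commute[of w y])
  qed simp
  also have "\<dots> = (\<integral>\<^sup>+w. \<integral>\<^sup>+y. K * ((a w)\<^sup>2 * ?I w * ?k w y) \<partial>lborel \<partial>lborel)"
    by (rule lborel_pair.Fubini') measurable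
  also have "\<dots> = (\<integral>\<^sup>+w. K * ((a w)\<^sup>2 * ?I w) * (\<integral>\<^sup>+y. ?k w y \<partial>lborel) \<partial>lborel)"
    by (simp only: mult.assoc[symmetric]) (simp add: nn_integral_cmult mult.assoc)
  also have "\<dots> \<le> (\<integral>\<^sup>+w. K * ((a w)\<^sup>2 * ?I w) * K \<partial>lborel)"
    by (intro nn_integral_mono mult_left_mono K) simp
  also have "\<dots> = K\<^sup>2 * (\<integral>\<^sup>+w. (a w)\<^sup>2 * ?I w \<partial>lborel)"
    by (subst nn_integral_cmult[symmetric]) (auto simp: power2_eq_square mult_ac)
  finally show ?thesis .
qed

text \<open>The two terms on the right are the local part, controlled by the mass \<open>K\<close> of the kernel through \<open>schur_test_ball\<close>,
  and the tail, controlled pointwise by \<open>far_cauchy_schwarz\<close> and then integrated over the ball. The radius of the ball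
  is also the radius at which the kernel is split.\<close>
lemma morrey_kernel_bound:
  assumes "0 < \<beta>"
  obtains C where "0 \<le> C"
    "\<And>(a :: 'a::euclidean_space \<Rightarrow> ennreal) A k K D x r.
      \<lbrakk>a \<in> borel_measurable borel; ball_growth (\<lambda>w. (a w)\<^sup>2) A (real DIM('a) - 2); 0 < r;
       k \<in> borel_measurable borel; \<And>t. 0 \<le> k t; 0 \<le> D;
       \<And>y::'a. (\<integral>\<^sup>+w. ennreal (k (dist y w)) * indicator (ball y r) w \<partial>lborel) \<le> K;
       \<And>t. r \<le> t \<Longrightarrow> k t \<le> D * t powr (1 - real DIM('a) - \<beta>)\<rbrakk> \<Longrightarrow>
      (\<integral>\<^sup>+y. (\<integral>\<^sup>+w. a w * ennreal (k (dist y w)) \<partial>lborel)\<^sup>2 * indicator (ball x r) y \<partial>lborel)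
        \<le> A * ennreal C * (K\<^sup>2 * ennreal (r powr (real DIM('a) - 2))
            + ennreal (D\<^sup>2 * r powr (real DIM('a) - 2 * \<beta>)))"
proof -
  define n where "n = real DIM('a)"
  define V where "V = unit_ball_vol n"
  have V: "0 \<le> V" by (simp add: V_def n_def)
  obtain C1 where C1: "0 \<le> C1" and far:
    "\<And>(a :: 'a \<Rightarrow> ennreal) A y r.
      \<lbrakk>a \<in> borel_measurable borel; ball_growth (\<lambda>w. (a w)\<^sup>2) A (n - 2); 0 < r\<rbrakk> \<Longrightarrow>
      (\<integral>\<^sup>+w. a w * ennreal (dist y w powr (1 - n - \<beta>)) * indicator (- ball y r) w \<partial>lborel)\<^sup>2
        \<le> A * ennreal (C1 * r powr (- 2 * \<beta>))"
    unfolding n_def using far_cauchy_schwarz[OF assms] by blast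
  define C where "C = 4 * (2 powr (n - 2) + C1 * V)"
  show ?thesis
  proof (rule that)
    show "0 \<le> C" using C1 V by (simp add: C_def)
    fix a :: "'a \<Rightarrow> ennreal" and A k K D x and r :: real
    assume a[measurable]: "a \<in> borel_measurable borel"
      and growth: "ball_growth (\<lambda>w. (a w)\<^sup>2) A (real DIM('a) - 2)" and r: "0 < r"
      and [measurable]: "k \<in> borel_measurable borel" and k: "\<And>t. 0 \<le> k t" and D: "0 \<le> D"
      and K: "\<And>y::'a. (\<integral>\<^sup>+w. ennreal (k (dist y w)) * indicator (ball y r) w \<partial>lborel) \<le> K"
      and decay: "\<And>t. r \<le> t \<Longrightarrow> k t \<le> D * t powr (1 - real DIM('a) - \<beta>)"
    define N where "N y = (\<integral>\<^sup>+w. a w * ennreal (k (dist y w)) * indicator (ball y r) w \<partial>lborel)" for y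
    define F where "F y = (\<integral>\<^sup>+w. a w * ennreal (k (dist y w)) * indicator (- ball y r) w \<partial>lborel)" for y
    have [measurable]: "N \<in> borel_measurable borel" "F \<in> borel_measurable borel"
      unfolding N_def[abs_def] F_def[abs_def] by measurable
    have split: "(\<integral>\<^sup>+w. a w * ennreal (k (dist y w)) \<partial>lborel) = N y + F y" for y
      unfolding N_def F_def by (subst nn_integral_add[symmetric]) (auto intro!: nn_integral_cong split: split_indicator)
    have N: "(\<integral>\<^sup>+y. (N y)\<^sup>2 * indicator (ball x r) y \<partial>lborel) \<le> K\<^sup>2 * (A * ennreal ((2 * r) powr (n - 2)))"
    proof -
      have "(\<integral>\<^sup>+y. (N y)\<^sup>2 * indicator (ball x r) y \<partial>lborel)
          \<le> K\<^sup>2 * (\<integral>\<^sup>+w. (a w)\<^sup>2 * indicator (ball x (2 * r)) w \<partial>lborel)"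
        unfolding N_def by (rule schur_test_ball) (use k K in auto)
      also have "\<dots> \<le> K\<^sup>2 * (A * ennreal ((2 * r) powr (n - 2)))"
        using growth r by (intro mult_left_mono) (auto simp: ball_growth_def n_def)
      finally show ?thesis .
    qed
    have F: "(F y)\<^sup>2 \<le> ennreal (D\<^sup>2) * (A * ennreal (C1 * r powr (- 2 * \<beta>)))" for y
    proof -
      have "F y \<le> (\<integral>\<^sup>+w. ennreal D * (a w * ennreal (dist y w powr (1 - n - \<beta>)) * indicator (- ball y r) w) \<partial>lborel)"
        unfolding F_def
      proof (intro nn_integral_mono)
        fix w
        show "a w * ennreal (k (dist y w)) * indicator (- ball y r) w
            \<le> ennreal D * (a w * ennreal (dist y w powr (1 - n - \<beta>)) * indicator (- ball y r) w)"
        proof (cases "r \<le> dist y w")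
          case True
          then have "ennreal (k (dist y w)) \<le> ennreal D * ennreal (dist y w powr (1 - n - \<beta>))"
            using decay[of "dist y w"] D by (simp add: n_def ennreal_mult[symmetric])
          then have "a w * ennreal (k (dist y w)) \<le> a w * (ennreal D * ennreal (dist y w powr (1 - n - \<beta>)))"
            by (rule mult_left_mono) simp
          then show ?thesis by (simp add: mult_ac split: split_indicator)
        qed simp
      qed
      also have "\<dots> = ennreal D * (\<integral>\<^sup>+w. a w * ennreal (dist y w powr (1 - n - \<beta>)) * indicator (- ball y r) w \<partial>lborel)"
        by (rule nn_integral_cmult) measurable
      finally have "(F y)\<^sup>2 \<le> (ennreal D)\<^sup>2 * (\<integral>\<^sup>+w. a w * ennreal (dist y w powr (1 - n - \<beta>)) * indicator (- ball y r) w \<partial>lborel)\<^sup>2"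
        by (subst power_mult_distrib[symmetric]) (intro power_mono, auto)
      also have "\<dots> \<le> (ennreal D)\<^sup>2 * (A * ennreal (C1 * r powr (- 2 * \<beta>)))"
        using far[OF a _ r] growth by (intro mult_left_mono) (auto simp: n_def)
      finally show ?thesis using D by (simp add: ennreal_power)
    qed
    have "(\<integral>\<^sup>+y. (F y)\<^sup>2 * indicator (ball x r) y \<partial>lborel)
        \<le> (\<integral>\<^sup>+y. ennreal (D\<^sup>2) * (A * ennreal (C1 * r powr (- 2 * \<beta>))) * indicator (ball x r) y \<partial>lborel)"
      by (intro nn_integral_mono mult_right_mono F) simp
    also have "\<dots> = ennreal (D\<^sup>2) * (A * ennreal (C1 * r powr (- 2 * \<beta>))) * ennreal (V * r powr n)"
      using r by (simp add: nn_integral_cmult emeasure_ball V_def n_def powr_realpow)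
    also have "\<dots> = A * (ennreal (D\<^sup>2) * ennreal (C1 * r powr (- 2 * \<beta>)) * ennreal (V * r powr n))"
      by (simp only: mult_ac)
    also have "ennreal (D\<^sup>2) * ennreal (C1 * r powr (- 2 * \<beta>)) * ennreal (V * r powr n)
        = ennreal (C1 * V) * ennreal (D\<^sup>2 * r powr (n - 2 * \<beta>))"
    proof -
      have "r powr (n - 2 * \<beta>) = r powr (- 2 * \<beta>) * r powr n" by (simp add: powr_add[symmetric])
      then have "D\<^sup>2 * (C1 * r powr (- 2 * \<beta>)) * (V * r powr n) = C1 * V * (D\<^sup>2 * r powr (n - 2 * \<beta>))"
        by (simp only: mult_ac)
      then show ?thesis using C1 V
        by (simp only: ennreal_mult[symmetric] mult_nonneg_nonneg powr_ge_zero zero_le_power2)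
    qed
    finally have Fint: "(\<integral>\<^sup>+y. (F y)\<^sup>2 * indicator (ball x r) y \<partial>lborel)
        \<le> A * (ennreal (C1 * V) * ennreal (D\<^sup>2 * r powr (n - 2 * \<beta>)))" .
    have "(\<integral>\<^sup>+y. (\<integral>\<^sup>+w. a w * ennreal (k (dist y w)) \<partial>lborel)\<^sup>2 * indicator (ball x r) y \<partial>lborel)
        \<le> (\<integral>\<^sup>+y. 4 * ((N y)\<^sup>2 * indicator (ball x r) y + (F y)\<^sup>2 * indicator (ball x r) y) \<partial>lborel)"
      unfolding split using ennreal_add_square_le
      by (intro nn_integral_mono) (auto split: split_indicator)
    also have "\<dots> = 4 * ((\<integral>\<^sup>+y. (N y)\<^sup>2 * indicator (ball x r) y \<partial>lborel)
        + (\<integral>\<^sup>+y. (F y)\<^sup>2 * indicator (ball x r) y \<partial>lborel))"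
      by (subst nn_integral_cmult, measurable) (subst nn_integral_add, auto)
    also have "\<dots> \<le> 4 * (K\<^sup>2 * (A * ennreal ((2 * r) powr (n - 2)))
        + A * (ennreal (C1 * V) * ennreal (D\<^sup>2 * r powr (n - 2 * \<beta>))))"
      by (intro mult_left_mono add_mono N Fint) simp
    also have "\<dots> \<le> A * ennreal C * (K\<^sup>2 * ennreal (r powr (n - 2)) + ennreal (D\<^sup>2 * r powr (n - 2 * \<beta>)))"
    proof -
      have 1: "4 * ennreal ((2 * r) powr (n - 2)) \<le> ennreal C * ennreal (r powr (n - 2))"
      proof -
        have "4 * ((2 * r) powr (n - 2)) \<le> C * r powr (n - 2)"
          using r C1 V by (simp add: C_def powr_mult algebra_simps)
        then have "ennreal (4 * ((2 * r) powr (n - 2))) \<le> ennreal (C * r powr (n - 2))" by (rule ennreal_leI)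
        then show ?thesis using C1 V by (simp add: ennreal_mult C_def)
      qed
      have 2: "4 * ennreal (C1 * V) \<le> ennreal C"
      proof -
        have "ennreal (4 * (C1 * V)) \<le> ennreal C" by (rule ennreal_leI) (simp add: C_def)
        then show ?thesis using C1 V by (simp add: ennreal_mult)
      qed
      have "4 * (K\<^sup>2 * (A * ennreal ((2 * r) powr (n - 2)))
        + A * (ennreal (C1 * V) * ennreal (D\<^sup>2 * r powr (n - 2 * \<beta>))))
        = A * K\<^sup>2 * (4 * ennreal ((2 * r) powr (n - 2)))
          + A * (4 * ennreal (C1 * V)) * ennreal (D\<^sup>2 * r powr (n - 2 * \<beta>))"
        by (simp add: distrib_left mult_ac)
      also have "\<dots> \<le> A * K\<^sup>2 * (ennreal C * ennreal (r powr (n - 2)))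
          + A * ennreal C * ennreal (D\<^sup>2 * r powr (n - 2 * \<beta>))"
        by (intro add_mono mult_left_mono mult_right_mono 1 2) auto
      also have "\<dots> = A * ennreal C * (K\<^sup>2 * ennreal (r powr (n - 2)) + ennreal (D\<^sup>2 * r powr (n - 2 * \<beta>)))"
        by (simp add: distrib_left mult_ac)
      finally show ?thesis .
    qed
    finally show "(\<integral>\<^sup>+y. (\<integral>\<^sup>+w. a w * ennreal (k (dist y w)) \<partial>lborel)\<^sup>2 * indicator (ball x r) y \<partial>lborel)
        \<le> A * ennreal C * (K\<^sup>2 * ennreal (r powr (real DIM('a) - 2))
            + ennreal (D\<^sup>2 * r powr (real DIM('a) - 2 * \<beta>)))"
      unfolding n_def .
  qed
qed

section \<open>Square Morrey functions as densities of polynomial growth\<close>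
lemma ennsqrt_le_iff:
  assumes "0 \<le> m"
  shows "ennsqrt z \<le> ennreal m \<longleftrightarrow> z \<le> ennreal (m\<^sup>2)"
proof (cases z)
  case (real x)
  have "sqrt x \<le> m \<longleftrightarrow> x \<le> m\<^sup>2"
    using assms real by (metis real_sqrt_le_iff real_sqrt_unique)
  then show ?thesis using real assms by (simp add: ennsqrt_def)
next
  case top
  then show ?thesis by (simp add: ennsqrt_def top_unique)
qed

lemma SUP_ennsqrt_finite:
  fixes J :: "real \<Rightarrow> 'a \<Rightarrow> ennreal"
  assumes K: "K < top" and bound: "\<And>r x. 0 < r \<Longrightarrow> ennreal (r powr e) * J r x \<le> K"
  shows "(SUP (r, x)\<in>{0::real<..} \<times> UNIV. ennsqrt (ennreal (r powr e) * J r x)) < top"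
proof -
  have "(SUP (r, x)\<in>{0::real<..} \<times> UNIV. ennsqrt (ennreal (r powr e) * J r x)) \<le> ennreal (sqrt (enn2real K))"
  proof (rule SUP_least)
    fix p :: "real \<times> 'a" assume "p \<in> {0<..} \<times> UNIV"
    then obtain r x where p: "p = (r, x)" "0 < r" by (cases p) auto
    then have "ennreal (r powr e) * J r x \<le> ennreal (enn2real K)"
      using bound[of r x] K by simp
    then show "(case p of (r, x) \<Rightarrow> ennsqrt (ennreal (r powr e) * J r x)) \<le> ennreal (sqrt (enn2real K))"
      using p(1) by (simp add: ennsqrt_le_iff)
  qed
  then show ?thesis by (rule order.strict_trans1) simp
qed

text \<open>Tonelli's theorem is applied to Lebesgue-Borel measure below, so the modulus is replaced by a Borel function
  equal to it almost everywhere.\<close>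
lemma morrey_ball_growth:
  fixes g :: "'a::euclidean_space \<Rightarrow> complex"
  assumes "g \<in> morrey"
  obtains a A where "a \<in> borel_measurable borel" "AE w in lborel. ennreal (cmod (g w)) = a w"
    "0 \<le> A" "ball_growth (\<lambda>w. (a w)\<^sup>2) (ennreal A) (real DIM('a) - 2)"
proof -
  define n where "n = real DIM('a)"
  have [measurable]: "g \<in> borel_measurable lebesgue" and fin: "morrey_norm g < top"
    using assms by (auto simp: morrey_def L2_loc_def)
  have "(\<lambda>w. ennreal (cmod (g w))) \<in> borel_measurable lebesgue" by measurable
  from completion_ex_borel_measurable[OF this] obtain a
    where a: "a \<in> borel_measurable lborel" "AE w in lborel. ennreal (cmod (g w)) = a w" by blast
  obtain m where m: "0 \<le> m" "morrey_norm g = ennreal m"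
    using fin by (cases "morrey_norm g") auto
  have "ball_growth (\<lambda>w. (a w)\<^sup>2) (ennreal (m\<^sup>2)) (n - 2)"
    unfolding ball_growth_def
  proof (intro allI impI)
    fix y :: 'a and s :: real assume s: "0 < s"
    let ?J = "\<integral>\<^sup>+w\<in>ball y s. ennreal ((cmod (g w))\<^sup>2) \<partial>lebesgue"
    have J: "?J = (\<integral>\<^sup>+w. (a w)\<^sup>2 * indicator (ball y s) w \<partial>lborel)"
      unfolding nn_integral_completion
      by (rule nn_integral_cong_AE) (use a(2) in eventually_elim, simp add: ennreal_power[symmetric])
    have "ennsqrt (ennreal (s powr (2 - n)) * ?J) \<le> morrey_norm g"
      unfolding morrey_norm_def n_def using s
      by (intro SUP_upper2[of "(s, y)"]) auto
    then have *: "ennreal (s powr (2 - n)) * ?J \<le> ennreal (m\<^sup>2)"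
      using m by (simp add: ennsqrt_le_iff)
    have "s powr (n - 2) * s powr (2 - n) = 1"
      using s by (simp add: powr_add[symmetric])
    then have "?J = ennreal (s powr (n - 2)) * (ennreal (s powr (2 - n)) * ?J)"
      by (simp add: mult.assoc[symmetric] ennreal_mult[symmetric])
    also have "\<dots> \<le> ennreal (s powr (n - 2)) * ennreal (m\<^sup>2)"
      by (intro mult_left_mono *) simp
    finally show "(\<integral>\<^sup>+w. (a w)\<^sup>2 * indicator (ball y s) w \<partial>lborel) \<le> ennreal (m\<^sup>2) * ennreal (s powr (n - 2))"
      unfolding J by (simp add: mult.commute)
  qed
  with a show ?thesis by (intro that[of a "m\<^sup>2"]) (auto simp: n_def)
qed

section \<open>Riesz potentials lie in every Q space\<close>

text \<open>A Hoelder type estimate. For \<open>u \<le> v\<close>, Bernoulli's inequality gives \<open>1 - (u/v)\<^sup>m \<le> m (1 - u/v)\<close>, and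
  \<open>1 - u/v \<le> (1 - u/v)\<^sup>\<beta> \<le> ((v - u)/u)\<^sup>\<beta>\<close> because \<open>1 - u/v\<close> lies between 0 and 1. Trading the full power of the
  increment for the power \<open>\<beta>\<close> keeps the singularity of the right-hand side locally integrable.\<close>
lemma powr_difference_bound:
  fixes u v \<beta> :: real
  assumes "0 < u" "0 < v" "0 \<le> \<beta>" "\<beta> \<le> 1"
  shows "\<bar>u powr (- real m) - v powr (- real m)\<bar>
    \<le> real m * \<bar>u - v\<bar> powr \<beta> * (u powr (- real m - \<beta>) + v powr (- real m - \<beta>))"
proof -
  have *: "\<bar>u powr (- real m) - v powr (- real m)\<bar> \<le> real m * \<bar>u - v\<bar> powr \<beta> * u powr (- real m - \<beta>)"
    if uv: "0 < u" "u \<le> v" for u v :: real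
  proof -
    have "1 - u / v \<le> (1 - u / v) powr \<beta>"
      using uv assms powr_mono'[of \<beta> 1 "1 - u / v"] by (cases "u = v") (auto simp: field_simps)
    also have "1 - u / v = (v - u) / v" using uv by (simp add: field_simps)
    also have "((v - u) / v) powr \<beta> \<le> ((v - u) / u) powr \<beta>"
      using uv assms by (intro powr_mono2 divide_left_mono) auto
    also have "\<dots> = (v - u) powr \<beta> * u powr - \<beta>"
      using uv by (simp add: powr_divide powr_minus field_simps)
    finally have h: "(v - u) / v \<le> (v - u) powr \<beta> * u powr - \<beta>" .
    have "1 + real m * (u / v - 1) \<le> (1 + (u / v - 1)) ^ m"
      using uv by (intro Bernoulli_inequality) simp
    then have "1 - (u / v) ^ m \<le> real m * ((v - u) / v)"
      using uv by (simp add: field_simps)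
    also have "\<dots> \<le> real m * ((v - u) powr \<beta> * u powr - \<beta>)"
      by (intro mult_left_mono h) simp
    finally have b: "1 - (u / v) ^ m \<le> real m * ((v - u) powr \<beta> * u powr - \<beta>)" .
    have "v powr - real m \<le> u powr - real m"
      using uv by (intro powr_mono2') auto
    moreover have "u powr (- real m) - v powr (- real m) = u powr (- real m) * (1 - (u / v) ^ m)"
      using uv by (simp add: powr_minus powr_realpow field_simps)
    moreover have "u powr (- real m) * (1 - (u / v) ^ m)
        \<le> u powr (- real m) * (real m * ((v - u) powr \<beta> * u powr - \<beta>))"
      by (intro mult_left_mono b) simp
    moreover have "u powr (- real m - \<beta>) = u powr (- real m) * u powr - \<beta>"
      by (simp add: powr_add[symmetric])
    ultimately show ?thesis using uv by (simp add: mult_ac)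
  qed
  show ?thesis
  proof (cases "u \<le> v")
    case True
    have "real m * \<bar>u - v\<bar> powr \<beta> * u powr (- real m - \<beta>)
        \<le> real m * \<bar>u - v\<bar> powr \<beta> * (u powr (- real m - \<beta>) + v powr (- real m - \<beta>))"
      by (intro mult_left_mono) auto
    with *[of u v] True assms show ?thesis by linarith
  next
    case False
    have "real m * \<bar>v - u\<bar> powr \<beta> * v powr (- real m - \<beta>)
        \<le> real m * \<bar>v - u\<bar> powr \<beta> * (u powr (- real m - \<beta>) + v powr (- real m - \<beta>))"
      by (intro mult_left_mono) auto
    with *[of v u] False assms show ?thesis by (simp add: abs_minus_commute)
  qed
qed

lemma riesz_kernel_difference:
  fixes w y z :: "'a::euclidean_space"
  assumes "w \<noteq> y" "w \<noteq> z" "0 \<le> \<beta>" "\<beta> \<le> 1"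
  shows "\<bar>norm (w - y) powr (1 - real DIM('a)) - norm (w - z) powr (1 - real DIM('a))\<bar>
    \<le> real DIM('a) * dist y z powr \<beta>
      * (dist y w powr (1 - real DIM('a) - \<beta>) + dist z w powr (1 - real DIM('a) - \<beta>))"
proof -
  define m where "m = DIM('a) - 1"
  have m: "1 - real DIM('a) = - real m" "real m \<le> real DIM('a)"
    using DIM_positive[where 'a='a] by (auto simp: m_def of_nat_diff)
  have "\<bar>dist y w - dist z w\<bar> \<le> dist y z"
    using dist_triangle[of y w z] dist_triangle[of z w y] by (simp add: dist_commute abs_le_iff)
  then have "real m * \<bar>dist y w - dist z w\<bar> powr \<beta> \<le> real DIM('a) * dist y z powr \<beta>"
    using assms m(2) by (intro mult_mono powr_mono2) auto
  then have "real m * \<bar>dist y w - dist z w\<bar> powr \<beta> * (dist y w powr (- real m - \<beta>) + dist z w powr (- real m - \<beta>))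
      \<le> real DIM('a) * dist y z powr \<beta> * (dist y w powr (- real m - \<beta>) + dist z w powr (- real m - \<beta>))"
    by (intro mult_right_mono) auto
  with powr_difference_bound[of "dist y w" "dist z w" \<beta> m] assms
  show ?thesis unfolding m(1) by (simp add: dist_norm norm_minus_commute)
qed

text \<open>The Riesz potential of order \<open>1 - \<beta>\<close> of \<open>a\<close>, without its normalizing constant.\<close>
definition fractional_potential :: "real \<Rightarrow> ('a::euclidean_space \<Rightarrow> ennreal) \<Rightarrow> 'a \<Rightarrow> ennreal" where
  "fractional_potential \<beta> a y = (\<integral>\<^sup>+w. a w * ennreal (dist y w powr (1 - real DIM('a) - \<beta>)) \<partial>lborel)"

lemma measurable_fractional_potential [measurable]:
  assumes [measurable]: "a \<in> borel_measurable borel"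
  shows "fractional_potential \<beta> a \<in> borel_measurable borel"
  unfolding fractional_potential_def[abs_def] by measurable

text \<open>The kernel \<open>t powr (1 - n - \<beta>)\<close> has mass of order \<open>r powr (1 - \<beta>)\<close> in balls of radius \<open>r\<close>, since \<open>\<beta> < 1\<close>, and
  it is its own tail bound, since \<open>\<beta> > 0\<close>.\<close>
lemma fractional_potential_bound:
  assumes "0 < \<beta>" "\<beta> < 1"
  obtains C where "0 \<le> C"
    "\<And>(a :: 'a::euclidean_space \<Rightarrow> ennreal) A x r.
      \<lbrakk>a \<in> borel_measurable borel; ball_growth (\<lambda>w. (a w)\<^sup>2) A (real DIM('a) - 2); 0 < r\<rbrakk> \<Longrightarrow>
      (\<integral>\<^sup>+y. (fractional_potential \<beta> a y)\<^sup>2 * indicator (ball x r) y \<partial>lborel)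
        \<le> A * ennreal (C * r powr (real DIM('a) - 2 * \<beta>))"
proof -
  define n where "n = real DIM('a)"
  define V where "V = unit_ball_vol n"
  have V: "0 \<le> V" by (simp add: V_def n_def)
  have \<beta>: "0 < 1 - \<beta>" using assms by simp
  obtain C0 where C0: "0 \<le> C0" and near:
    "\<And>(G :: 'a \<Rightarrow> ennreal) A y r. \<lbrakk>G \<in> borel_measurable borel; ball_growth G A n; 0 < r\<rbrakk> \<Longrightarrow>
      (\<integral>\<^sup>+w. G w * ennreal (dist y w powr (- n + (1 - \<beta>))) * indicator (ball y r) w \<partial>lborel)
        \<le> A * ennreal (C0 * r powr (1 - \<beta>))"
    using near_integral[OF \<beta>] by blast
  obtain C1 where C1: "0 \<le> C1" and kernel:
    "\<And>(a :: 'a \<Rightarrow> ennreal) A k K D x r.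
      \<lbrakk>a \<in> borel_measurable borel; ball_growth (\<lambda>w. (a w)\<^sup>2) A (real DIM('a) - 2); 0 < r;
       k \<in> borel_measurable borel; \<And>t. 0 \<le> k t; 0 \<le> D;
       \<And>y::'a. (\<integral>\<^sup>+w. ennreal (k (dist y w)) * indicator (ball y r) w \<partial>lborel) \<le> K;
       \<And>t. r \<le> t \<Longrightarrow> k t \<le> D * t powr (1 - real DIM('a) - \<beta>)\<rbrakk> \<Longrightarrow>
      (\<integral>\<^sup>+y. (\<integral>\<^sup>+w. a w * ennreal (k (dist y w)) \<partial>lborel)\<^sup>2 * indicator (ball x r) y \<partial>lborel)
        \<le> A * ennreal C1 * (K\<^sup>2 * ennreal (r powr (real DIM('a) - 2))
            + ennreal (D\<^sup>2 * r powr (real DIM('a) - 2 * \<beta>)))"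
    using morrey_kernel_bound[OF assms(1), where 'a='a] by blast
  show ?thesis
  proof (rule that)
    show "0 \<le> C1 * ((V * C0)\<^sup>2 + 1)" using C1 by simp
    fix a :: "'a \<Rightarrow> ennreal" and A x and r :: real
    assume a: "a \<in> borel_measurable borel"
      and growth: "ball_growth (\<lambda>w. (a w)\<^sup>2) A (real DIM('a) - 2)" and r: "0 < r"
    let ?K = "ennreal (V * C0 * r powr (1 - \<beta>))"
    have "(\<integral>\<^sup>+w. ennreal (dist y w powr (1 - n - \<beta>)) * indicator (ball y r) w \<partial>lborel) \<le> ?K" for y :: 'a
    proof -
      have eq: "- n + (1 - \<beta>) = 1 - n - \<beta>" by simp
      show ?thesis
        using near[of "\<lambda>_. 1" "ennreal V" r y, unfolded eq] ball_growth_lebesgue[where 'a='a] r C0 V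
        by (simp add: V_def n_def ennreal_mult mult.assoc)
    qed
    then have "(\<integral>\<^sup>+y. (fractional_potential \<beta> a y)\<^sup>2 * indicator (ball x r) y \<partial>lborel)
        \<le> A * ennreal C1 * (?K\<^sup>2 * ennreal (r powr (n - 2)) + ennreal (1\<^sup>2 * r powr (n - 2 * \<beta>)))"
      unfolding fractional_potential_def n_def
      by (intro kernel[OF a growth r, of "\<lambda>t. t powr (1 - real DIM('a) - \<beta>)" 1]) auto
    also have "?K\<^sup>2 * ennreal (r powr (n - 2)) + ennreal (1\<^sup>2 * r powr (n - 2 * \<beta>))
        = ennreal (((V * C0)\<^sup>2 + 1) * r powr (n - 2 * \<beta>))"
    proof -
      have "(r powr (1 - \<beta>))\<^sup>2 * r powr (n - 2) = r powr (n - 2 * \<beta>)"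
        by (simp add: power2_eq_square powr_add[symmetric])
      then have "(V * C0 * r powr (1 - \<beta>))\<^sup>2 * r powr (n - 2) + 1\<^sup>2 * r powr (n - 2 * \<beta>)
          = ((V * C0)\<^sup>2 + 1) * r powr (n - 2 * \<beta>)"
        by (simp add: power_mult_distrib distrib_right mult.assoc)
      then show ?thesis
        using V C0 by (simp add: ennreal_power ennreal_mult[symmetric] ennreal_plus[symmetric] del: ennreal_plus)
    qed
    also have "A * ennreal C1 * \<dots> = A * ennreal (C1 * ((V * C0)\<^sup>2 + 1) * r powr (n - 2 * \<beta>))"
      using C1 by (simp add: mult.assoc ennreal_mult)
    finally show "(\<integral>\<^sup>+y. (fractional_potential \<beta> a y)\<^sup>2 * indicator (ball x r) y \<partial>lborel)
        \<le> A * ennreal (C1 * ((V * C0)\<^sup>2 + 1) * r powr (real DIM('a) - 2 * \<beta>))"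
      unfolding n_def .
  qed
qed

lemma sigma_finite_lebesgue: "sigma_finite_measure (lebesgue :: 'a::euclidean_space measure)"
proof
  obtain \<A> :: "'a set set" where \<A>: "countable \<A>" "\<A> \<subseteq> sets lborel" "\<Union> \<A> = space lborel"
    "\<forall>a\<in>\<A>. emeasure lborel a \<noteq> \<infinity>"
    using sigma_finite_lborel[THEN sigma_finite_measure.sigma_finite_countable] by blast
  have S: "a \<in> sets lebesgue \<and> emeasure lebesgue a \<noteq> \<infinity>" if "a \<in> \<A>" for a
  proof -
    have "a \<in> sets lborel" "emeasure lborel a \<noteq> \<infinity>" using that \<A> by blast+
    moreover from this(1) have "a \<in> sets lebesgue" by (rule sets_completionI_sets)
    ultimately show ?thesis by (simp del: sets_lborel)
  qed
  have U: "\<Union> \<A> = space lebesgue"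
    using \<A>(3) by (simp only: space_completion)
  show "\<exists>A :: 'a set set. countable A \<and> A \<subseteq> sets lebesgue \<and> \<Union> A = space lebesgue \<and> (\<forall>a\<in>A. emeasure lebesgue a \<noteq> \<infinity>)"
    by (intro exI[of _ \<A>] conjI ballI subsetI \<A>(1) U S[THEN conjunct1] S[THEN conjunct2])
qed

lemma measurable_ident_lebesgue:
  "(\<lambda>x. x) \<in> lebesgue \<rightarrow>\<^sub>M (borel :: 'a::euclidean_space measure)"
  using measurable_completion[of "\<lambda>x::'a. x" lborel borel] by simp

lemma measurable_projections_lebesgue:
  "fst \<in> lebesgue \<Otimes>\<^sub>M lebesgue \<rightarrow>\<^sub>M (borel :: 'a::euclidean_space measure)"
  "snd \<in> lebesgue \<Otimes>\<^sub>M lebesgue \<rightarrow>\<^sub>M (borel :: 'a::euclidean_space measure)"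
  by (rule measurable_compose[OF measurable_fst measurable_ident_lebesgue]
      measurable_compose[OF measurable_snd measurable_ident_lebesgue])+

text \<open>A pointwise bound for increments, as for a fractional Hajlasz gradient \<open>I\<close>, reduces the double integral to
  \<open>\<integral> I(y)\<^sup>2 \<integral> |y - z|\<^sup>2\<^sup>\<beta>\<^sup>-\<^sup>2\<^sup>\<alpha>\<^sup>-\<^sup>n dz dy\<close> and its mirror image. The strict inequality \<open>\<alpha> < \<beta>\<close> makes the inner
  integral converge.\<close>
lemma Q_seminorm_finite:
  fixes f :: "'a::euclidean_space \<Rightarrow> complex" and I :: "'a \<Rightarrow> ennreal"
  assumes [measurable]: "f \<in> borel_measurable lebesgue" "I \<in> borel_measurable borel"
    and "\<alpha> < \<beta>" "0 \<le> B" "0 \<le> E"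
    and diff: "AE y in lborel. AE z in lborel. ennreal (cmod (f y - f z)) \<le> ennreal (B * dist y z powr \<beta>) * (I y + I z)"
    and energy: "\<And>x r. 0 < r \<Longrightarrow> (\<integral>\<^sup>+y. (I y)\<^sup>2 * indicator (ball x r) y \<partial>lborel) \<le> ennreal (E * r powr (real DIM('a) - 2 * \<beta>))"
  shows "Q_seminorm \<alpha> f < top"
proof -
  define n where "n = real DIM('a)"
  define V where "V = unit_ball_vol n"
  have V: "0 \<le> V" by (simp add: V_def n_def)
  define \<gamma> where "\<gamma> = 2 * (\<beta> - \<alpha>)"
  have \<gamma>: "0 < \<gamma>" using assms by (simp add: \<gamma>_def)
  obtain C where C: "0 \<le> C" and near:
    "\<And>(G :: 'a \<Rightarrow> ennreal) A y r. \<lbrakk>G \<in> borel_measurable borel; ball_growth G A n; 0 < r\<rbrakk> \<Longrightarrow>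
      (\<integral>\<^sup>+w. G w * ennreal (dist y w powr (- n + \<gamma>)) * indicator (ball y r) w \<partial>lborel)
        \<le> A * ennreal (C * r powr \<gamma>)"
    using near_integral[OF \<gamma>] by blast
  define K where "K = 4 * B\<^sup>2 * (2 * (E * (V * C * 2 powr \<gamma>)))"
  interpret L: sigma_finite_measure "lebesgue :: 'a measure" by (rule sigma_finite_lebesgue)
  show ?thesis
    unfolding Q_seminorm_def
  proof (rule SUP_ennsqrt_finite)
    show "ennreal K < top" by simp
    fix r :: real and x :: 'a assume r: "0 < r"
    define b where "b y = (indicator (ball x r) y :: ennreal)" for y
    have [measurable]: "b \<in> borel_measurable borel" unfolding b_def[abs_def] by measurable
    define F where "F y z = ennreal ((cmod (f y - f z))\<^sup>2 / norm (y - z) powr (n + 2 * \<alpha>))" for y z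
    have Fm: "(\<lambda>p. F (fst p) (snd p) * indicator (ball x r \<times> ball x r) p) \<in> borel_measurable (lebesgue \<Otimes>\<^sub>M lebesgue)"
    proof -
      note [measurable] = measurable_projections_lebesgue
      have "(\<lambda>p. F (fst p) (snd p) * (indicator (ball x r) (fst p) * indicator (ball x r) (snd p)))
          \<in> borel_measurable (lebesgue \<Otimes>\<^sub>M lebesgue)"
        unfolding F_def by measurable
      then show ?thesis by (simp add: indicator_times)
    qed
    have symm: "(\<integral>\<^sup>+y. \<integral>\<^sup>+z. b y * b z * ennreal (dist y z powr (- n + \<gamma>)) * (I z)\<^sup>2 \<partial>lborel \<partial>lborel)
        = (\<integral>\<^sup>+y. \<integral>\<^sup>+z. b y * b z * ennreal (dist y z powr (- n + \<gamma>)) * (I y)\<^sup>2 \<partial>lborel \<partial>lborel)"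
      by (subst lborel_pair.Fubini', measurable) (simp add: dist_commute mult_ac)
    have main: "(\<integral>\<^sup>+y. \<integral>\<^sup>+z. b y * b z * ennreal (dist y z powr (- n + \<gamma>)) * (I y)\<^sup>2 \<partial>lborel \<partial>lborel)
        \<le> ennreal (E * (V * C * 2 powr \<gamma>) * r powr (n - 2 * \<alpha>))"
    proof -
      have "(\<integral>\<^sup>+y. \<integral>\<^sup>+z. b y * b z * ennreal (dist y z powr (- n + \<gamma>)) * (I y)\<^sup>2 \<partial>lborel \<partial>lborel)
          \<le> (\<integral>\<^sup>+y. \<integral>\<^sup>+z. (I y)\<^sup>2 * b y * (1 * ennreal (dist y z powr (- n + \<gamma>)) * indicator (ball y (2 * r)) z) \<partial>lborel \<partial>lborel)"
      proof (intro nn_integral_mono)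
        fix y z
        have "dist y z < 2 * r" if "dist x y < r" "dist x z < r"
          using that dist_triangle[of y z x] by (simp add: dist_commute)
        then show "b y * b z * ennreal (dist y z powr (- n + \<gamma>)) * (I y)\<^sup>2
            \<le> (I y)\<^sup>2 * b y * (1 * ennreal (dist y z powr (- n + \<gamma>)) * indicator (ball y (2 * r)) z)"
          by (auto simp: b_def mult_ac split: split_indicator)
      qed
      also have "\<dots> = (\<integral>\<^sup>+y. (I y)\<^sup>2 * b y * (\<integral>\<^sup>+z. 1 * ennreal (dist y z powr (- n + \<gamma>)) * indicator (ball y (2 * r)) z \<partial>lborel) \<partial>lborel)"
        by (intro nn_integral_cong nn_integral_cmult) measurable
      also have "\<dots> \<le> (\<integral>\<^sup>+y. (I y)\<^sup>2 * b y * (ennreal V * ennreal (C * (2 * r) powr \<gamma>)) \<partial>lborel)"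
        using ball_growth_lebesgue[where 'a='a] r
        by (intro nn_integral_mono mult_left_mono near) (auto simp: V_def n_def)
      also have "\<dots> = (\<integral>\<^sup>+y. (I y)\<^sup>2 * b y \<partial>lborel) * (ennreal V * ennreal (C * (2 * r) powr \<gamma>))"
        by (rule nn_integral_multc) measurable
      also have "\<dots> \<le> ennreal (E * r powr (n - 2 * \<beta>)) * (ennreal V * ennreal (C * (2 * r) powr \<gamma>))"
        using energy[OF r, of x] by (intro mult_right_mono) (auto simp: b_def n_def)
      also have "\<dots> = ennreal (E * (V * C * 2 powr \<gamma>) * r powr (n - 2 * \<alpha>))"
      proof -
        have "r powr (n - 2 * \<alpha>) = r powr (n - 2 * \<beta>) * r powr \<gamma>"
          by (simp add: powr_add[symmetric] \<gamma>_def)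
        then have "E * r powr (n - 2 * \<beta>) * (V * (C * (2 * r) powr \<gamma>)) = E * (V * C * 2 powr \<gamma>) * r powr (n - 2 * \<alpha>)"
          using r by (simp add: powr_mult)
        then show ?thesis using assms(5) V C by (simp add: ennreal_mult[symmetric])
      qed
      finally show ?thesis .
    qed
    have pw: "F y z * (b y * b z) \<le> ennreal (4 * B\<^sup>2)
          * (b y * b z * ennreal (dist y z powr (- n + \<gamma>)) * (I y)\<^sup>2 + b y * b z * ennreal (dist y z powr (- n + \<gamma>)) * (I z)\<^sup>2)"
      if "ennreal (cmod (f y - f z)) \<le> ennreal (B * dist y z powr \<beta>) * (I y + I z)" for y z
    proof -
      let ?d = "dist y z"
      have "F y z = (ennreal (cmod (f y - f z)))\<^sup>2 * ennreal (1 / ?d powr (n + 2 * \<alpha>))"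
        by (simp add: F_def ennreal_power ennreal_mult[symmetric] dist_norm)
      also have "\<dots> \<le> (ennreal (B * ?d powr \<beta>) * (I y + I z))\<^sup>2 * ennreal (1 / ?d powr (n + 2 * \<alpha>))"
        by (intro mult_right_mono power_mono that) auto
      also have "\<dots> \<le> (ennreal (B * ?d powr \<beta>))\<^sup>2 * (4 * ((I y)\<^sup>2 + (I z)\<^sup>2)) * ennreal (1 / ?d powr (n + 2 * \<alpha>))"
        unfolding power_mult_distrib by (intro mult_right_mono mult_left_mono ennreal_add_square_le) auto
      also have "\<dots> = (4 * ((ennreal (B * ?d powr \<beta>))\<^sup>2 * ennreal (1 / ?d powr (n + 2 * \<alpha>)))) * ((I y)\<^sup>2 + (I z)\<^sup>2)"
        by (simp only: mult_ac)
      also have "4 * ((ennreal (B * ?d powr \<beta>))\<^sup>2 * ennreal (1 / ?d powr (n + 2 * \<alpha>)))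
          = ennreal (4 * B\<^sup>2) * ennreal (?d powr (- n + \<gamma>))"
      proof -
        have "?d powr (- n + \<gamma>) = (?d powr \<beta>)\<^sup>2 / ?d powr (n + 2 * \<alpha>)"
          by (simp add: power2_eq_square powr_add[symmetric] powr_diff[symmetric] \<gamma>_def algebra_simps)
        then have "4 * ((B * ?d powr \<beta>)\<^sup>2 * (1 / ?d powr (n + 2 * \<alpha>))) = 4 * B\<^sup>2 * ?d powr (- n + \<gamma>)"
          by (simp add: power_mult_distrib)
        moreover have "4 * ennreal X = ennreal (4 * X)" if "0 \<le> X" for X
          using that by (simp add: ennreal_mult)
        ultimately show ?thesis using assms(4) by (simp add: ennreal_power ennreal_mult[symmetric])
      qed
      finally have "F y z * (b y * b z) \<le> ennreal (4 * B\<^sup>2) * ennreal (?d powr (- n + \<gamma>)) * ((I y)\<^sup>2 + (I z)\<^sup>2) * (b y * b z)"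
        by (rule mult_right_mono) simp
      also have "\<dots> = ennreal (4 * B\<^sup>2)
          * (b y * b z * ennreal (?d powr (- n + \<gamma>)) * (I y)\<^sup>2 + b y * b z * ennreal (?d powr (- n + \<gamma>)) * (I z)\<^sup>2)"
        by (simp only: distrib_left distrib_right mult_ac)
      finally show ?thesis .
    qed
    have "(\<integral>\<^sup>+p\<in>ball x r \<times> ball x r. F (fst p) (snd p) \<partial>(lebesgue \<Otimes>\<^sub>M lebesgue))
        = (\<integral>\<^sup>+y. \<integral>\<^sup>+z. F y z * (b y * b z) \<partial>lborel \<partial>lborel)"
      using L.nn_integral_fst[OF Fm] by (simp add: nn_integral_completion indicator_times b_def)
    also have "\<dots> \<le> (\<integral>\<^sup>+y. \<integral>\<^sup>+z. ennreal (4 * B\<^sup>2)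
          * (b y * b z * ennreal (dist y z powr (- n + \<gamma>)) * (I y)\<^sup>2 + b y * b z * ennreal (dist y z powr (- n + \<gamma>)) * (I z)\<^sup>2) \<partial>lborel \<partial>lborel)"
    proof (rule nn_integral_mono_AE)
      show "AE y in lborel. (\<integral>\<^sup>+z. F y z * (b y * b z) \<partial>lborel) \<le> (\<integral>\<^sup>+z. ennreal (4 * B\<^sup>2)
          * (b y * b z * ennreal (dist y z powr (- n + \<gamma>)) * (I y)\<^sup>2 + b y * b z * ennreal (dist y z powr (- n + \<gamma>)) * (I z)\<^sup>2) \<partial>lborel)"
        using diff
      proof eventually_elim
        case (elim y)
        show ?case
          by (rule nn_integral_mono_AE, use elim in eventually_elim) (rule pw)
      qed
    qed
    also have "\<dots> = ennreal (4 * B\<^sup>2) * ((\<integral>\<^sup>+y. \<integral>\<^sup>+z. b y * b z * ennreal (dist y z powr (- n + \<gamma>)) * (I y)\<^sup>2 \<partial>lborel \<partial>lborel)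
        + (\<integral>\<^sup>+y. \<integral>\<^sup>+z. b y * b z * ennreal (dist y z powr (- n + \<gamma>)) * (I z)\<^sup>2 \<partial>lborel \<partial>lborel))"
      by (simp add: nn_integral_cmult nn_integral_add)
    also have "\<dots> \<le> ennreal (4 * B\<^sup>2) * (ennreal (E * (V * C * 2 powr \<gamma>) * r powr (n - 2 * \<alpha>)) + ennreal (E * (V * C * 2 powr \<gamma>) * r powr (n - 2 * \<alpha>)))"
      unfolding symm by (intro mult_left_mono add_mono main) auto
    also have "\<dots> = ennreal (K * r powr (n - 2 * \<alpha>))"
      using assms(4,5) V C
      by (subst ennreal_plus[symmetric], simp, simp, subst ennreal_mult[symmetric]) (auto simp: K_def mult_ac)
    finally have "ennreal (r powr (2 * \<alpha> - n)) * (\<integral>\<^sup>+p\<in>ball x r \<times> ball x r. F (fst p) (snd p) \<partial>(lebesgue \<Otimes>\<^sub>M lebesgue))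
        \<le> ennreal (r powr (2 * \<alpha> - n)) * ennreal (K * r powr (n - 2 * \<alpha>))"
      by (rule mult_left_mono) simp
    also have "\<dots> = ennreal K"
    proof -
      have "r powr (2 * \<alpha> - n) * (K * r powr (n - 2 * \<alpha>)) = K * (r powr (2 * \<alpha> - n) * r powr (n - 2 * \<alpha>))"
        by (simp only: mult_ac)
      also have "\<dots> = K" using r by (simp add: powr_add[symmetric])
      finally show ?thesis using assms(4,5) V C by (subst ennreal_mult[symmetric]) (auto simp: K_def)
    qed
    finally show "ennreal (r powr (2 * \<alpha> - real DIM('a))) *
        (\<integral>\<^sup>+p\<in>ball x r \<times> ball x r. ennreal ((cmod (f (fst p) - f (snd p)))\<^sup>2
             / norm (fst p - snd p) powr (real DIM('a) + 2 * \<alpha>)) \<partial>(lebesgue \<Otimes>\<^sub>M lebesgue)) \<le> ennreal K"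
      unfolding F_def n_def .
  qed
qed

text \<open>\<open>T y\<close> is the renormalized integrand at the point \<open>y\<close>. Once \<open>T y\<close> and \<open>T z\<close> are known to be integrable, the
  renormalization cancels in the difference and \<open>riesz_kernel_difference\<close> applies. Integrability at a point \<open>p\<close> where
  the fractional potential is finite is seen separately on both sides of the unit sphere. Outside, the difference of kernels is
  compared with the points \<open>p\<close> and 0. Inside, where nothing is subtracted, \<open>|w - p|\<^sup>1\<^sup>-\<^sup>n\<close> is at most
  \<open>(1 + |p|)\<^sup>\<beta>|w - p|\<^sup>1\<^sup>-\<^sup>n\<^sup>-\<^sup>\<beta>\<close>.\<close>
lemma riesz_potential_difference:
  fixes g :: "'a::euclidean_space \<Rightarrow> complex" and a :: "'a \<Rightarrow> ennreal"
  defines "T y w \<equiv> g w * complex_of_real (norm (w - y) powr (1 - real DIM('a))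
          - norm w powr (1 - real DIM('a)) * indicator {y. 1 < norm y} w)"
  assumes g[measurable]: "g \<in> borel_measurable lebesgue" and a[measurable]: "a \<in> borel_measurable borel"
    and ga: "AE w in lborel. ennreal (cmod (g w)) = a w"
    and growth: "ball_growth (\<lambda>w. (a w)\<^sup>2) (ennreal A) (real DIM('a) - 2)"
    and \<beta>: "0 < \<beta>" "\<beta> \<le> 1"
    and y: "fractional_potential \<beta> a y < \<infinity>" and z: "fractional_potential \<beta> a z < \<infinity>"
  shows "ennreal (cmod ((\<integral>w. T y w \<partial>lebesgue) - (\<integral>w. T z w \<partial>lebesgue)))
    \<le> ennreal (real DIM('a) * dist y z powr \<beta>) * (fractional_potential \<beta> a y + fractional_potential \<beta> a z)"
proof -
  define n where "n = real DIM('a)"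
  define q where "q = 1 - n - \<beta>"
  let ?far = "\<lambda>w. a w * ennreal (dist 0 w powr q) * indicator (- ball 0 1) w"
  note [measurable] = measurable_ident_lebesgue
  have ne: "AE w in lborel. w \<noteq> p" for p :: 'a by (rule AE_lborel_singleton)
  have farfin: "(\<integral>\<^sup>+w. ?far w \<partial>lborel) < \<infinity>"
  proof -
    obtain C where "0 \<le> C" and C: "\<And>(a :: 'a \<Rightarrow> ennreal) A y r.
      \<lbrakk>a \<in> borel_measurable borel; ball_growth (\<lambda>w. (a w)\<^sup>2) A (real DIM('a) - 2); 0 < r\<rbrakk> \<Longrightarrow>
      (\<integral>\<^sup>+w. a w * ennreal (dist y w powr (1 - real DIM('a) - \<beta>)) * indicator (- ball y r) w \<partial>lborel)\<^sup>2
        \<le> A * ennreal (C * r powr (- 2 * \<beta>))"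
      using far_cauchy_schwarz[OF \<beta>(1), where 'a='a] by blast
    have "(\<integral>\<^sup>+w. ?far w \<partial>lborel)\<^sup>2 \<le> ennreal A * ennreal (C * 1 powr (- 2 * \<beta>))"
      using C[OF a growth zero_less_one, of 0] unfolding q_def n_def .
    also have "\<dots> < \<infinity>" by (simp add: ennreal_mult_less_top)
    finally show ?thesis by (simp add: power_less_top_ennreal)
  qed
  have int: "integrable lebesgue (T p)" if p: "fractional_potential \<beta> a p < \<infinity>" for p
  proof (rule integrableI_bounded)
    show "T p \<in> borel_measurable lebesgue" unfolding T_def[abs_def] by measurable
    define M where "M = (1 + norm p) powr \<beta> + n * norm p powr \<beta>"
    have M: "0 \<le> M" by (simp add: M_def n_def)
    have kernel: "\<bar>norm (w - p) powr (1 - n) - norm w powr (1 - n) * indicator {y. 1 < norm y} w\<bar>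
        \<le> M * (dist p w powr q + dist 0 w powr q * indicator (- ball 0 1) w)" if w: "w \<noteq> p" "w \<noteq> 0" for w
    proof (cases "1 < norm w")
      case True
      then have "\<bar>norm (w - p) powr (1 - n) - norm w powr (1 - n) * indicator {y. 1 < norm y} w\<bar>
          \<le> n * norm p powr \<beta> * (dist p w powr q + dist 0 w powr q * indicator (- ball 0 1) w)"
        using riesz_kernel_difference[of w p 0 \<beta>] w \<beta> by (simp add: n_def q_def)
      also have "\<dots> \<le> M * (dist p w powr q + dist 0 w powr q * indicator (- ball 0 1) w)"
        by (intro mult_right_mono) (auto simp: M_def)
      finally show ?thesis .
    next
      case False
      have "dist p w \<le> 1 + norm p"
        using False norm_triangle_ineq4[of p w] by (simp add: dist_norm)
      then have "dist p w powr \<beta> \<le> (1 + norm p) powr \<beta>" using \<beta> by (intro powr_mono2) auto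
      also have "\<dots> \<le> M" by (simp add: M_def n_def)
      finally have "dist p w powr \<beta> * dist p w powr q \<le> M * dist p w powr q"
        by (rule mult_right_mono) simp
      also have "\<dots> \<le> M * (dist p w powr q + dist 0 w powr q * indicator (- ball 0 1) w)"
        using M by (intro mult_left_mono) auto
      also have "dist p w powr \<beta> * dist p w powr q = dist p w powr (1 - n)"
        by (simp add: powr_add[symmetric] q_def)
      finally show ?thesis using False by (simp add: dist_norm norm_minus_commute)
    qed
    have "(\<integral>\<^sup>+w. ennreal (norm (T p w)) \<partial>lebesgue)
        \<le> (\<integral>\<^sup>+w. ennreal M * (a w * ennreal (dist p w powr q) + ?far w) \<partial>lborel)"
      unfolding nn_integral_completion
    proof (rule nn_integral_mono_AE)
      show "AE w in lborel. ennreal (norm (T p w)) \<le> ennreal M * (a w * ennreal (dist p w powr q) + ?far w)"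
        using ga ne[of p] ne[of 0]
      proof eventually_elim
        case (elim w)
        let ?k = "\<bar>norm (w - p) powr (1 - n) - norm w powr (1 - n) * indicator {y. 1 < norm y} w\<bar>"
        have "ennreal (norm (T p w)) = a w * ennreal ?k"
          unfolding T_def n_def norm_mult norm_of_real ennreal_mult'[OF norm_ge_zero] elim(1) ..
        also have "\<dots> \<le> a w * ennreal (M * (dist p w powr q + dist 0 w powr q * indicator (- ball 0 1) w))"
          by (intro mult_left_mono ennreal_leI kernel elim) simp
        also have "\<dots> = ennreal M * (a w * ennreal (dist p w powr q) + ?far w)"
          using M by (simp add: ennreal_mult distrib_left mult_ac split: split_indicator)
        finally show ?case .
      qed
    qed
    also have "\<dots> = ennreal M * (fractional_potential \<beta> a p + (\<integral>\<^sup>+w. ?far w \<partial>lborel))"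
      by (simp add: nn_integral_cmult nn_integral_add fractional_potential_def q_def n_def)
    also have "\<dots> < \<infinity>" using p farfin by (simp add: ennreal_mult_less_top)
    finally show "(\<integral>\<^sup>+w. ennreal (norm (T p w)) \<partial>lebesgue) < \<infinity>" .
  qed
  have "(\<integral>w. T y w \<partial>lebesgue) - (\<integral>w. T z w \<partial>lebesgue) = (\<integral>w. T y w - T z w \<partial>lebesgue)"
    using int[OF y] int[OF z] by simp
  then have "ennreal (cmod ((\<integral>w. T y w \<partial>lebesgue) - (\<integral>w. T z w \<partial>lebesgue)))
      \<le> (\<integral>\<^sup>+w. ennreal (norm (T y w - T z w)) \<partial>lebesgue)"
    using integral_norm_bound_ennreal[of lebesgue "\<lambda>w. T y w - T z w"] int[OF y] int[OF z] by simp
  also have "\<dots> \<le> (\<integral>\<^sup>+w. ennreal (n * dist y z powr \<beta>) * (a w * ennreal (dist y w powr q) + a w * ennreal (dist z w powr q)) \<partial>lborel)"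
    unfolding nn_integral_completion
  proof (rule nn_integral_mono_AE)
    show "AE w in lborel. ennreal (norm (T y w - T z w))
        \<le> ennreal (n * dist y z powr \<beta>) * (a w * ennreal (dist y w powr q) + a w * ennreal (dist z w powr q))"
      using ga ne[of y] ne[of z]
    proof eventually_elim
      case (elim w)
      have "T y w - T z w = g w * complex_of_real (norm (w - y) powr (1 - n) - norm (w - z) powr (1 - n))"
        by (simp add: T_def n_def algebra_simps)
      then have "ennreal (norm (T y w - T z w)) = a w * ennreal \<bar>norm (w - y) powr (1 - n) - norm (w - z) powr (1 - n)\<bar>"
        by (simp only: norm_mult norm_of_real ennreal_mult'[OF norm_ge_zero] elim(1))
      also have "\<dots> \<le> a w * ennreal (n * dist y z powr \<beta> * (dist y w powr q + dist z w powr q))"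
        using riesz_kernel_difference[OF elim(2,3), of \<beta>] \<beta>
        by (intro mult_left_mono ennreal_leI) (auto simp: n_def q_def)
      also have "\<dots> = ennreal (n * dist y z powr \<beta>) * (a w * ennreal (dist y w powr q) + a w * ennreal (dist z w powr q))"
        by (simp add: n_def ennreal_mult distrib_left mult_ac)
      finally show ?case .
    qed
  qed
  also have "\<dots> = ennreal (n * dist y z powr \<beta>) * (fractional_potential \<beta> a y + fractional_potential \<beta> a z)"
    by (simp add: nn_integral_cmult nn_integral_add fractional_potential_def q_def n_def)
  finally show ?thesis by (simp add: n_def)
qed

text \<open>By \<open>fractional_potential_bound\<close> the fractional potential is square integrable on balls, hence finite almost everywhere, and
  \<open>riesz_potential_difference\<close> is then available for almost all pairs of points.\<close>
lemma riesz_potential_in_Q_space: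
  fixes f :: "'a::euclidean_space \<Rightarrow> complex"
  assumes f: "f \<in> riesz_potential_morrey" and \<alpha>: "0 < \<alpha>" "\<alpha> < 1"
  shows "f \<in> Q_space \<alpha>"
proof -
  define n where "n = real DIM('a)"
  obtain g c where g: "g \<in> morrey" and f_eq: "AE x in lebesgue. f x = c + (\<integral>w. g w * complex_of_real
        (norm (w - x) powr (1 - real DIM('a)) - norm w powr (1 - real DIM('a)) * indicator {w. 1 < norm w} w) \<partial>lebesgue)"
    using f unfolding riesz_potential_morrey_def by blast
  define h where "h x = (\<integral>w. g w * complex_of_real
        (norm (w - x) powr (1 - real DIM('a)) - norm w powr (1 - real DIM('a)) * indicator {w. 1 < norm w} w) \<partial>lebesgue)" for x
  have f_AE: "AE x in lebesgue. f x = c + h x"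
    using f_eq by (simp only: h_def)
  have [measurable]: "g \<in> borel_measurable lebesgue"
    using g by (auto simp: morrey_def L2_loc_def)
  obtain a A where a[measurable]: "a \<in> borel_measurable borel" and ga: "AE w in lborel. ennreal (cmod (g w)) = a w"
    and A: "0 \<le> A" and growth: "ball_growth (\<lambda>w. (a w)\<^sup>2) (ennreal A) (real DIM('a) - 2)"
    using morrey_ball_growth[OF g] by blast
  \<comment> \<open>Any exponent strictly between \<open>\<alpha>\<close> and 1 would do.\<close>
  define \<beta> where "\<beta> = (1 + \<alpha>) / 2"
  have \<beta>: "0 < \<beta>" "\<beta> < 1" "\<alpha> < \<beta>" using \<alpha> by (auto simp: \<beta>_def)
  obtain C where C: "0 \<le> C" and bound:
    "\<And>(a :: 'a \<Rightarrow> ennreal) A x r.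
      \<lbrakk>a \<in> borel_measurable borel; ball_growth (\<lambda>w. (a w)\<^sup>2) A (real DIM('a) - 2); 0 < r\<rbrakk> \<Longrightarrow>
      (\<integral>\<^sup>+y. (fractional_potential \<beta> a y)\<^sup>2 * indicator (ball x r) y \<partial>lborel)
        \<le> A * ennreal (C * r powr (real DIM('a) - 2 * \<beta>))"
    using fractional_potential_bound[OF \<beta>(1,2), where 'a='a] by blast
  note energy = bound[OF a growth]
  have fm: "f \<in> borel_measurable lebesgue"
  proof -
    interpret L: sigma_finite_measure "lebesgue :: 'a measure" by (rule sigma_finite_lebesgue)
    note [measurable] = measurable_projections_lebesgue
    have "h \<in> borel_measurable lebesgue"
      unfolding h_def[abs_def]
    proof (rule L.borel_measurable_lebesgue_integral)
      show "(\<lambda>(x, w). g w * complex_of_real (norm (w - x) powr (1 - real DIM('a))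
          - norm w powr (1 - real DIM('a)) * indicator {w. 1 < norm w} w)) \<in> borel_measurable (lebesgue \<Otimes>\<^sub>M lebesgue)"
        unfolding split_beta by measurable
    qed
    then have "(\<lambda>x. c + h x) \<in> borel_measurable lebesgue" by measurable
    then show ?thesis
      by (rule borel_measurable_AE) (use f_AE in eventually_elim, simp)
  qed
  have fin: "AE y in lborel. fractional_potential \<beta> a y < \<infinity>"
  proof -
    have "AE y in lborel. y \<in> ball 0 (real (Suc N)) \<longrightarrow> fractional_potential \<beta> a y < \<infinity>" for N
    proof -
      have "(\<integral>\<^sup>+y. (fractional_potential \<beta> a y)\<^sup>2 * indicator (ball 0 (real (Suc N))) y \<partial>lborel) < \<infinity>"
        using energy[of "real (Suc N)" 0]
        by (rule order.strict_trans1) (simp_all add: ennreal_mult_less_top)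
      then have "AE y in lborel. (fractional_potential \<beta> a y)\<^sup>2 * indicator (ball 0 (real (Suc N))) y \<noteq> \<infinity>"
        by (intro nn_integral_PInf_AE) auto
      then show ?thesis
        by eventually_elim (auto simp: power_less_top_ennreal less_top)
    qed
    then have "AE y in lborel. \<forall>N. y \<in> ball 0 (real (Suc N)) \<longrightarrow> fractional_potential \<beta> a y < \<infinity>"
      by (subst AE_all_countable) blast
    then show ?thesis
    proof eventually_elim
      case (elim y)
      obtain N where "norm y < real N" using reals_Archimedean2 by blast
      then have "y \<in> ball 0 (real (Suc N))" by simp
      with elim show ?case by blast
    qed
  qed
  have f_AE': "AE x in lborel. f x = c + h x"
    using f_AE by (simp add: AE_completion_iff)
  have "Q_seminorm \<alpha> f < top"
  proof (rule Q_seminorm_finite[OF fm _ \<beta>(3)])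
    show "fractional_potential \<beta> a \<in> borel_measurable borel" by measurable
    show "0 \<le> real DIM('a)" "0 \<le> A * C" using A C by auto
    show "(\<integral>\<^sup>+y. (fractional_potential \<beta> a y)\<^sup>2 * indicator (ball x r) y \<partial>lborel)
        \<le> ennreal (A * C * r powr (real DIM('a) - 2 * \<beta>))" if "0 < r" for x r
      using energy[OF that, of x] A C by (simp add: ennreal_mult mult.assoc)
    show "AE y in lborel. AE z in lborel. ennreal (cmod (f y - f z))
        \<le> ennreal (real DIM('a) * dist y z powr \<beta>) * (fractional_potential \<beta> a y + fractional_potential \<beta> a z)"
      using fin f_AE'
    proof eventually_elim
      case y: (elim y)
      show ?case using fin f_AE'
      proof eventually_elim
        case z: (elim z)
        have "f y - f z = h y - h z" using y z by simp
        then show ?case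
          using riesz_potential_difference[OF _ a ga growth \<beta>(1) less_imp_le[OF \<beta>(2)] y(1) z(1)]
          unfolding h_def by simp
      qed
    qed
  qed
  then show ?thesis using fm by (simp add: Q_space_def)
qed

section \<open>Heat extensions of square Morrey functions\<close>

text \<open>The heat kernel as a function of the distance, the form in which \<open>morrey_kernel_bound\<close> accepts kernels.\<close>
definition heat_profile :: "nat \<Rightarrow> real \<Rightarrow> real \<Rightarrow> real" where
  "heat_profile n t s = (4 * pi * t) powr (- real n / 2) * exp (- s\<^sup>2 / (4 * t))"

lemma heat_profile_nonneg: "0 \<le> heat_profile n t s"
  by (simp add: heat_profile_def)

lemma heat_profile_le:
  assumes "0 < t"
  shows "heat_profile n t s \<le> t powr (- real n / 2)"
proof -
  have "t \<le> 4 * pi * t" using assms pi_gt3 by simp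
  then have "(4 * pi * t) powr (- real n / 2) \<le> t powr (- real n / 2)"
    using assms by (intro powr_mono2') auto
  moreover have "exp (- s\<^sup>2 / (4 * t)) \<le> 1" using assms by simp
  ultimately have "heat_profile n t s \<le> t powr (- real n / 2) * 1"
    unfolding heat_profile_def by (intro mult_mono) auto
  then show ?thesis by simp
qed

lemma power_le_exp:
  fixes v :: real
  assumes "0 \<le> v" "0 < N"
  shows "v ^ N \<le> real N ^ N * exp v"
proof -
  have "v / real N \<le> exp (v / real N)"
    using exp_ge_add_one_self[of "v / real N"] by linarith
  then have "(v / real N) ^ N \<le> exp (v / real N) ^ N"
    using assms by (intro power_mono) auto
  also have "\<dots> = exp v" using assms by (simp add: exp_of_nat_mult[symmetric])
  finally show ?thesis using assms by (simp add: power_divide field_simps)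
qed

text \<open>With \<open>v = s / \<surd>t\<close>, the Gaussian \<open>exp (- v\<^sup>2 / 4)\<close> is at most \<open>exp (1 - v)\<close>, because \<open>(v / 2 - 1)\<^sup>2 \<ge> 0\<close>, and the
  exponential beats the power \<open>v\<^sup>n\<^sup>+\<^sup>1\<close>. This power is the one that turns \<open>t powr (- n / 2)\<close> into \<open>sqrt t\<close>.\<close>
lemma heat_profile_decay:
  assumes t: "0 < t" and s: "0 < s"
  shows "heat_profile n t s \<le> exp 1 * real (Suc n) ^ Suc n * sqrt t * s powr (- real n - 1)"
proof -
  define v where "v = s / sqrt t"
  have v: "0 < v" using t s by (simp add: v_def)
  have v2: "- s\<^sup>2 / (4 * t) = - (v\<^sup>2 / 4)" using t by (simp add: v_def power_divide)
  have "0 \<le> (v / 2 - 1)\<^sup>2" by simp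
  then have "v \<le> 1 + v\<^sup>2 / 4" by (simp add: power2_eq_square algebra_simps)
  then have "exp (- (v\<^sup>2 / 4)) \<le> exp (1 - v)" by simp
  also have "\<dots> = exp 1 / exp v" by (rule exp_diff)
  also have "\<dots> \<le> exp 1 * real (Suc n) ^ Suc n / v ^ Suc n"
    using power_le_exp[of v "Suc n"] v by (simp add: field_simps del: power_Suc of_nat_Suc)
  finally have e: "exp (- s\<^sup>2 / (4 * t)) \<le> exp 1 * real (Suc n) ^ Suc n / v ^ Suc n"
    unfolding v2 .
  have "t \<le> 4 * pi * t" using t pi_gt3 by simp
  then have "(4 * pi * t) powr (- real n / 2) \<le> t powr (- real n / 2)"
    using t by (intro powr_mono2') auto
  then have "heat_profile n t s \<le> t powr (- real n / 2) * (exp 1 * real (Suc n) ^ Suc n / v ^ Suc n)"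
    unfolding heat_profile_def by (intro mult_mono e) auto
  also have "\<dots> = exp 1 * real (Suc n) ^ Suc n * (t powr (- real n / 2) / v ^ Suc n)"
    by simp
  also have "t powr (- real n / 2) / v ^ Suc n = sqrt t * s powr (- real n - 1)"
  proof -
    have "v ^ Suc n = v powr (real n + 1)"
      using v powr_realpow[of v "Suc n"] by (simp add: add.commute)
    also have "\<dots> = s powr (real n + 1) / t powr ((real n + 1) / 2)"
      using t s by (simp add: v_def powr_divide powr_half_sqrt[symmetric] powr_powr)
    finally have "t powr (- real n / 2) / v ^ Suc n
        = t powr (- real n / 2) * t powr ((real n + 1) / 2) * (1 / s powr (real n + 1))"
      by simp
    also have "t powr (- real n / 2) * t powr ((real n + 1) / 2) = sqrt t"
      using t by (simp add: powr_add[symmetric] powr_half_sqrt[symmetric] field_simps)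
    also have "1 / s powr (real n + 1) = s powr (- real n - 1)"
      by (simp add: powr_minus_divide[symmetric])
    finally show ?thesis .
  qed
  finally show ?thesis by (simp only: mult.assoc)
qed

text \<open>Splitting the space at the parabolic scale makes the bound uniform in time. The split is at distance \<open>\<surd>t\<close>: inside,
  the kernel is at most \<open>t powr (- n / 2)\<close>; outside, \<open>heat_profile_decay\<close> and \<open>far_integral\<close> apply.\<close>
lemma heat_profile_integral_bounded:
  obtains K where "0 \<le> K"
    "\<And>t (y :: 'a::euclidean_space). 0 < t \<Longrightarrow> (\<integral>\<^sup>+w. ennreal (heat_profile DIM('a) t (dist y w)) \<partial>lborel) \<le> ennreal K"
proof -
  define n where "n = real DIM('a)"
  define V where "V = unit_ball_vol n"
  have V: "0 \<le> V" by (simp add: V_def n_def)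
  define H where "H = exp 1 * real (Suc DIM('a)) ^ Suc DIM('a)"
  have H: "0 \<le> H" by (simp add: H_def)
  obtain C where C: "0 \<le> C" and far:
    "\<And>(G :: 'a \<Rightarrow> ennreal) A y r. \<lbrakk>G \<in> borel_measurable borel; ball_growth G A n; 0 < r\<rbrakk> \<Longrightarrow>
      (\<integral>\<^sup>+w. G w * ennreal (dist y w powr (- n - 1)) * indicator (- ball y r) w \<partial>lborel)
        \<le> A * ennreal (C * r powr - 1)"
    using far_integral[OF zero_less_one] by blast
  show ?thesis
  proof (rule that)
    show "0 \<le> V + H * (V * C)" using V C H by simp
    fix t :: real and y :: 'a assume t: "0 < t"
    have "(\<integral>\<^sup>+w. ennreal (heat_profile DIM('a) t (dist y w)) \<partial>lborel)
        \<le> (\<integral>\<^sup>+w. ennreal (t powr (- n / 2)) * indicator (ball y (sqrt t)) w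
            + ennreal (H * sqrt t) * (1 * ennreal (dist y w powr (- n - 1)) * indicator (- ball y (sqrt t)) w) \<partial>lborel)"
    proof (intro nn_integral_mono)
      fix w
      show "ennreal (heat_profile DIM('a) t (dist y w)) \<le> ennreal (t powr (- n / 2)) * indicator (ball y (sqrt t)) w
            + ennreal (H * sqrt t) * (1 * ennreal (dist y w powr (- n - 1)) * indicator (- ball y (sqrt t)) w)"
      proof (cases "dist y w < sqrt t")
        case True
        then show ?thesis using heat_profile_le[OF t] by (simp add: n_def ennreal_leI)
      next
        case False
        then have "0 < dist y w" using t by (smt (verit) real_sqrt_gt_zero)
        then have "heat_profile DIM('a) t (dist y w) \<le> H * sqrt t * dist y w powr (- n - 1)"
          using heat_profile_decay[OF t] unfolding H_def n_def by blast
        then show ?thesis using False H t by (simp add: ennreal_mult[symmetric] ennreal_leI)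
      qed
    qed
    also have "\<dots> = ennreal (t powr (- n / 2)) * emeasure lborel (ball y (sqrt t))
        + ennreal (H * sqrt t) * (\<integral>\<^sup>+w. 1 * ennreal (dist y w powr (- n - 1)) * indicator (- ball y (sqrt t)) w \<partial>lborel)"
      by (subst nn_integral_add, measurable) (simp add: nn_integral_cmult)
    also have "\<dots> \<le> ennreal (t powr (- n / 2)) * ennreal (V * sqrt t powr n)
        + ennreal (H * sqrt t) * (ennreal V * ennreal (C * sqrt t powr - 1))"
      using t ball_growth_lebesgue[where 'a='a]
      by (intro add_mono mult_left_mono far) (auto simp: V_def n_def emeasure_ball powr_realpow)
    also have "\<dots> = ennreal (V + H * (V * C))"
    proof -
      have 1: "t powr (- n / 2) * (V * sqrt t powr n) = V"
      proof -
        have "sqrt t powr n = t powr (n / 2)"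
          using powr_powr[of t "1 / 2" n] t by (simp add: powr_half_sqrt)
        moreover have "t powr (- n / 2) * t powr (n / 2) = 1"
          using t by (simp add: powr_add[symmetric])
        ultimately show ?thesis by (simp add: mult.left_commute)
      qed
      have 2: "H * sqrt t * (V * (C * sqrt t powr - 1)) = H * (V * C)"
        using t by (simp add: powr_minus field_simps)
      have "ennreal (t powr (- n / 2)) * ennreal (V * sqrt t powr n) = ennreal V"
        using V by (simp only: ennreal_mult[symmetric] mult_nonneg_nonneg powr_ge_zero 1)
      moreover have "ennreal (H * sqrt t) * (ennreal V * ennreal (C * sqrt t powr - 1)) = ennreal (H * (V * C))"
        using V H C t
        by (simp only: ennreal_mult[symmetric] mult_nonneg_nonneg powr_ge_zero real_sqrt_ge_zero less_imp_le 2)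
      ultimately show ?thesis using V H C by simp
    qed
    finally show "(\<integral>\<^sup>+w. ennreal (heat_profile DIM('a) t (dist y w)) \<partial>lborel) \<le> ennreal (V + H * (V * C))" .
  qed
qed

text \<open>This is \<open>morrey_kernel_bound\<close> with \<open>\<beta> = 2\<close>. The factor \<open>sqrt t \<le> r\<close> in the decay of the kernel compensates
  the loss of two powers of the radius in the tail term, which makes both terms of order \<open>r powr (n - 2)\<close>.\<close>
lemma heat_extension_bound:
  obtains C where "0 \<le> C"
    "\<And>(a :: 'a::euclidean_space \<Rightarrow> ennreal) A x r t.
      \<lbrakk>a \<in> borel_measurable borel; ball_growth (\<lambda>w. (a w)\<^sup>2) A (real DIM('a) - 2); 0 < r; 0 < t; t \<le> r\<^sup>2\<rbrakk> \<Longrightarrow>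
      (\<integral>\<^sup>+y. (\<integral>\<^sup>+w. a w * ennreal (heat_profile DIM('a) t (dist y w)) \<partial>lborel)\<^sup>2 * indicator (ball x r) y \<partial>lborel)
        \<le> A * ennreal (C * r powr (real DIM('a) - 2))"
proof -
  define n where "n = real DIM('a)"
  define H where "H = exp 1 * real (Suc DIM('a)) ^ Suc DIM('a)"
  have H: "0 \<le> H" by (simp add: H_def)
  obtain K where K: "0 \<le> K" and mass:
    "\<And>t (y :: 'a). 0 < t \<Longrightarrow> (\<integral>\<^sup>+w. ennreal (heat_profile DIM('a) t (dist y w)) \<partial>lborel) \<le> ennreal K"
    using heat_profile_integral_bounded by blast
  obtain C1 where C1: "0 \<le> C1" and kernel:
    "\<And>(a :: 'a \<Rightarrow> ennreal) A k K D x r.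
      \<lbrakk>a \<in> borel_measurable borel; ball_growth (\<lambda>w. (a w)\<^sup>2) A (real DIM('a) - 2); 0 < r;
       k \<in> borel_measurable borel; \<And>t. 0 \<le> k t; 0 \<le> D;
       \<And>y::'a. (\<integral>\<^sup>+w. ennreal (k (dist y w)) * indicator (ball y r) w \<partial>lborel) \<le> K;
       \<And>t. r \<le> t \<Longrightarrow> k t \<le> D * t powr (1 - real DIM('a) - 2)\<rbrakk> \<Longrightarrow>
      (\<integral>\<^sup>+y. (\<integral>\<^sup>+w. a w * ennreal (k (dist y w)) \<partial>lborel)\<^sup>2 * indicator (ball x r) y \<partial>lborel)
        \<le> A * ennreal C1 * (K\<^sup>2 * ennreal (r powr (real DIM('a) - 2))
            + ennreal (D\<^sup>2 * r powr (real DIM('a) - 2 * 2)))"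
    using morrey_kernel_bound[of 2, where 'a='a] zero_less_numeral by blast
  show ?thesis
  proof (rule that)
    show "0 \<le> C1 * (K\<^sup>2 + H\<^sup>2)" using C1 by simp
    fix a :: "'a \<Rightarrow> ennreal" and A x and r t :: real
    assume a: "a \<in> borel_measurable borel" and growth: "ball_growth (\<lambda>w. (a w)\<^sup>2) A (real DIM('a) - 2)"
      and r: "0 < r" and t: "0 < t" "t \<le> r\<^sup>2"
    let ?k = "heat_profile DIM('a) t"
    have "(\<integral>\<^sup>+y. (\<integral>\<^sup>+w. a w * ennreal (?k (dist y w)) \<partial>lborel)\<^sup>2 * indicator (ball x r) y \<partial>lborel)
        \<le> A * ennreal C1 * ((ennreal K)\<^sup>2 * ennreal (r powr (real DIM('a) - 2))
            + ennreal ((H * r)\<^sup>2 * r powr (real DIM('a) - 2 * 2)))"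
    proof (rule kernel[OF a growth r])
      show "?k \<in> borel_measurable borel" unfolding heat_profile_def[abs_def] by measurable
      show "0 \<le> ?k s" for s by (rule heat_profile_nonneg)
      show "0 \<le> H * r" using H r by simp
      show "(\<integral>\<^sup>+w. ennreal (?k (dist y w)) * indicator (ball y r) w \<partial>lborel) \<le> ennreal K" for y :: 'a
        by (rule order_trans[OF nn_integral_mono mass[OF t(1), of y]]) (auto split: split_indicator)
      show "?k s \<le> H * r * s powr (1 - real DIM('a) - 2)" if s: "r \<le> s" for s
      proof -
        have eq: "1 - real DIM('a) - 2 = - real DIM('a) - 1" by simp
        have "sqrt t \<le> r" using t r real_le_lsqrt by simp
        then have "H * sqrt t * s powr (- real DIM('a) - 1) \<le> H * r * s powr (- real DIM('a) - 1)"
          using H by (intro mult_right_mono mult_left_mono) auto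
        moreover have "?k s \<le> H * sqrt t * s powr (- real DIM('a) - 1)"
          unfolding H_def using s r by (intro heat_profile_decay t) auto
        ultimately show ?thesis unfolding eq by linarith
      qed
    qed
    also have "(ennreal K)\<^sup>2 * ennreal (r powr (real DIM('a) - 2)) + ennreal ((H * r)\<^sup>2 * r powr (real DIM('a) - 2 * 2))
        = ennreal ((K\<^sup>2 + H\<^sup>2) * r powr (n - 2))"
    proof -
      have "r\<^sup>2 * r powr (n - 2 * 2) = r powr 2 * r powr (n - 2 * 2)"
        using r by simp
      also have "\<dots> = r powr (2 + (n - 2 * 2))" by (rule powr_add[symmetric])
      finally have "r\<^sup>2 * r powr (n - 2 * 2) = r powr (n - 2)" by simp
      then have "K\<^sup>2 * r powr (n - 2) + (H * r)\<^sup>2 * r powr (n - 2 * 2) = (K\<^sup>2 + H\<^sup>2) * r powr (n - 2)"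
        by (simp only: power_mult_distrib distrib_right mult.assoc)
      then show ?thesis
        using K by (simp add: n_def ennreal_power ennreal_mult[symmetric] ennreal_plus[symmetric] del: ennreal_plus)
    qed
    also have "A * ennreal C1 * \<dots> = A * ennreal (C1 * (K\<^sup>2 + H\<^sup>2) * r powr (n - 2))"
      using C1 by (simp add: mult.assoc ennreal_mult)
    finally show "(\<integral>\<^sup>+y. (\<integral>\<^sup>+w. a w * ennreal (?k (dist y w)) \<partial>lborel)\<^sup>2 * indicator (ball x r) y \<partial>lborel)
        \<le> A * ennreal (C1 * (K\<^sup>2 + H\<^sup>2) * r powr (real DIM('a) - 2))"
      unfolding n_def .
  qed
qed

lemma norm_integral_le_nn_integral:
  "ennreal (norm (\<integral>x. f x \<partial>M)) \<le> (\<integral>\<^sup>+x. ennreal (norm (f x)) \<partial>M)"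
  for f :: "'b \<Rightarrow> 'c::{banach, second_countable_topology}"
  by (cases "integrable M f") (auto simp: integral_norm_bound_ennreal not_integrable_integral_eq)

text \<open>The functional \<open>u\<close> enters only through its values on heat kernels. The integral of \<open>t powr (- \<alpha>)\<close> is read off
  from \<open>near_integral\<close> on the real line, where Lebesgue measure has growth exponent 1.\<close>
lemma Q_inv_norm_finite:
  fixes f :: "'a::euclidean_space \<Rightarrow> complex"
  assumes f: "f \<in> morrey" and \<alpha>: "\<alpha> < 1"
    and u: "\<And>t x. u (\<lambda>y. complex_of_real (heat_kernel t (x - y)))
              = (\<integral>y. f y * complex_of_real (heat_kernel t (x - y)) \<partial>lebesgue)"
  shows "Q_inv_norm \<alpha> u < top"
proof -
  define n where "n = real DIM('a)"
  obtain a A where a[measurable]: "a \<in> borel_measurable borel" and fa: "AE w in lborel. ennreal (cmod (f w)) = a w"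
    and A: "0 \<le> A" and growth: "ball_growth (\<lambda>w. (a w)\<^sup>2) (ennreal A) (real DIM('a) - 2)"
    using morrey_ball_growth[OF f] by blast
  obtain C where C: "0 \<le> C" and heat:
    "\<And>(a :: 'a \<Rightarrow> ennreal) A x r t.
      \<lbrakk>a \<in> borel_measurable borel; ball_growth (\<lambda>w. (a w)\<^sup>2) A (real DIM('a) - 2); 0 < r; 0 < t; t \<le> r\<^sup>2\<rbrakk> \<Longrightarrow>
      (\<integral>\<^sup>+y. (\<integral>\<^sup>+w. a w * ennreal (heat_profile DIM('a) t (dist y w)) \<partial>lborel)\<^sup>2 * indicator (ball x r) y \<partial>lborel)
        \<le> A * ennreal (C * r powr (real DIM('a) - 2))"
    using heat_extension_bound[where 'a='a] by blast
  have \<alpha>': "0 < 1 - \<alpha>" using \<alpha> by simp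
  obtain C2 where C2: "0 \<le> C2" and near:
    "\<And>(G :: real \<Rightarrow> ennreal) A y r. \<lbrakk>G \<in> borel_measurable borel; ball_growth G A 1; 0 < r\<rbrakk> \<Longrightarrow>
      (\<integral>\<^sup>+w. G w * ennreal (dist y w powr (- 1 + (1 - \<alpha>))) * indicator (ball y r) w \<partial>lborel)
        \<le> A * ennreal (C2 * r powr (1 - \<alpha>))"
    using near_integral[OF \<alpha>'] by blast
  define V where "V = unit_ball_vol 1"
  have V: "0 \<le> V" by (simp add: V_def)
  have heat_pw: "ennreal (cmod (heat_semigroup t u y)) \<le> (\<integral>\<^sup>+w. a w * ennreal (heat_profile DIM('a) t (dist y w)) \<partial>lborel)" for t y
  proof -
    have "ennreal (cmod (heat_semigroup t u y)) \<le> (\<integral>\<^sup>+w. ennreal (cmod (f w * complex_of_real (heat_kernel t (y - w)))) \<partial>lebesgue)"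
      unfolding heat_semigroup_def u by (rule norm_integral_le_nn_integral)
    also have "\<dots> = (\<integral>\<^sup>+w. a w * ennreal (heat_profile DIM('a) t (dist y w)) \<partial>lborel)"
      unfolding nn_integral_completion
    proof (rule nn_integral_cong_AE)
      have eq: "heat_kernel t (y - w) = heat_profile DIM('a) t (dist y w)" for w
        by (simp add: heat_kernel_def heat_profile_def dist_norm)
      show "AE w in lborel. ennreal (cmod (f w * complex_of_real (heat_kernel t (y - w))))
          = a w * ennreal (heat_profile DIM('a) t (dist y w))"
        using fa by eventually_elim (simp add: eq norm_mult heat_profile_nonneg ennreal_mult)
    qed
    finally show ?thesis .
  qed
  define K where "K = A * C * V * C2"
  show ?thesis
    unfolding Q_inv_norm_def
  proof (rule SUP_ennsqrt_finite)
    show "ennreal K < top" by simp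
    fix r :: real and x :: 'a assume r: "0 < r"
    have slice: "(\<integral>\<^sup>+y\<in>ball x r. ennreal ((cmod (heat_semigroup t u y))\<^sup>2) \<partial>lebesgue) \<le> ennreal (A * C * r powr (n - 2))"
      if "0 < t" "t < r\<^sup>2" for t
    proof -
      have "(\<integral>\<^sup>+y\<in>ball x r. ennreal ((cmod (heat_semigroup t u y))\<^sup>2) \<partial>lebesgue)
          \<le> (\<integral>\<^sup>+y. (\<integral>\<^sup>+w. a w * ennreal (heat_profile DIM('a) t (dist y w)) \<partial>lborel)\<^sup>2 * indicator (ball x r) y \<partial>lborel)"
        unfolding nn_integral_completion
        by (intro nn_integral_mono mult_right_mono) (auto simp: ennreal_power[symmetric] intro!: power_mono heat_pw)
      also have "\<dots> \<le> ennreal A * ennreal (C * r powr (n - 2))"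
        using heat[OF a growth r that(1) less_imp_le[OF that(2)], of x] by (simp add: n_def)
      also have "\<dots> = ennreal (A * C * r powr (n - 2))"
        using A C by (simp add: ennreal_mult[symmetric] mult.assoc)
      finally show ?thesis .
    qed
    have "(\<integral>\<^sup>+t\<in>{0<..<r\<^sup>2}. (\<integral>\<^sup>+y\<in>ball x r. ennreal ((cmod (heat_semigroup t u y))\<^sup>2) \<partial>lebesgue) * ennreal (t powr (- \<alpha>)) \<partial>lebesgue)
        \<le> (\<integral>\<^sup>+t. ennreal (A * C * r powr (n - 2)) * (1 * ennreal (dist (0::real) t powr (- 1 + (1 - \<alpha>))) * indicator (ball 0 (r\<^sup>2)) t) \<partial>lborel)"
      unfolding nn_integral_completion[of lborel "\<lambda>t::real. _ t"]
    proof (intro nn_integral_mono)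
      fix t :: real
      show "(\<integral>\<^sup>+y\<in>ball x r. ennreal ((cmod (heat_semigroup t u y))\<^sup>2) \<partial>lebesgue) * ennreal (t powr (- \<alpha>)) * indicator {0<..<r\<^sup>2} t
          \<le> ennreal (A * C * r powr (n - 2)) * (1 * ennreal (dist (0::real) t powr (- 1 + (1 - \<alpha>))) * indicator (ball 0 (r\<^sup>2)) t)"
      proof (cases "0 < t \<and> t < r\<^sup>2")
        case True
        then show ?thesis using mult_right_mono[OF slice[of t], of "ennreal (t powr - \<alpha>)"] by simp
      qed auto
    qed
    also have "\<dots> = ennreal (A * C * r powr (n - 2)) * (\<integral>\<^sup>+t. 1 * ennreal (dist (0::real) t powr (- 1 + (1 - \<alpha>))) * indicator (ball 0 (r\<^sup>2)) t \<partial>lborel)"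
      by (rule nn_integral_cmult) measurable
    also have "\<dots> \<le> ennreal (A * C * r powr (n - 2)) * (ennreal V * ennreal (C2 * (r\<^sup>2) powr (1 - \<alpha>)))"
      using r ball_growth_lebesgue[where 'a=real] by (intro mult_left_mono near) (auto simp: V_def)
    also have "\<dots> = ennreal (K * r powr (n - 2 * \<alpha>))"
    proof -
      have "(r\<^sup>2) powr (1 - \<alpha>) = r powr (2 - 2 * \<alpha>)"
        using r powr_realpow[of r 2] powr_powr[of r 2 "1 - \<alpha>"] by (simp add: algebra_simps)
      then have "r powr (n - 2) * (r\<^sup>2) powr (1 - \<alpha>) = r powr (n - 2 * \<alpha>)"
        by (simp add: powr_add[symmetric])
      then have "A * C * r powr (n - 2) * (V * (C2 * (r\<^sup>2) powr (1 - \<alpha>))) = K * r powr (n - 2 * \<alpha>)"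
        by (simp only: K_def mult_ac)
      then show ?thesis using A C V C2 by (simp add: ennreal_mult[symmetric])
    qed
    finally have "ennreal (r powr (2 * \<alpha> - n)) * (\<integral>\<^sup>+t\<in>{0<..<r\<^sup>2}. (\<integral>\<^sup>+y\<in>ball x r. ennreal ((cmod (heat_semigroup t u y))\<^sup>2) \<partial>lebesgue) * ennreal (t powr (- \<alpha>)) \<partial>lebesgue)
        \<le> ennreal (r powr (2 * \<alpha> - n)) * ennreal (K * r powr (n - 2 * \<alpha>))"
      by (rule mult_left_mono) simp
    also have "\<dots> = ennreal K"
    proof -
      have "r powr (2 * \<alpha> - n) * (K * r powr (n - 2 * \<alpha>)) = K * (r powr (2 * \<alpha> - n) * r powr (n - 2 * \<alpha>))"
        by (simp only: mult_ac)
      also have "\<dots> = K" using r by (simp add: powr_add[symmetric])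
      finally show ?thesis using A C V C2 by (subst ennreal_mult[symmetric]) (auto simp: K_def)
    qed
    finally show "ennreal (r powr (2 * \<alpha> - real DIM('a))) * (\<integral>\<^sup>+t\<in>{0<..<r\<^sup>2}.
           (\<integral>\<^sup>+y\<in>ball x r. ennreal ((cmod (heat_semigroup t u y))\<^sup>2) \<partial>lebesgue) * ennreal (t powr (- \<alpha>)) \<partial>lebesgue) \<le> ennreal K"
      unfolding n_def .
  qed
qed

section \<open>Square Morrey functions are tempered\<close>

text \<open>The unit ball is covered by local square integrability, its complement by \<open>far_cauchy_schwarz\<close> with \<open>\<beta> = 1\<close>.\<close>
lemma morrey_integral_weighted_finite:
  fixes a :: "'a::euclidean_space \<Rightarrow> ennreal"
  assumes a[measurable]: "a \<in> borel_measurable borel"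
    and growth: "ball_growth (\<lambda>w. (a w)\<^sup>2) (ennreal A) (real DIM('a) - 2)"
  shows "(\<integral>\<^sup>+w. a w * ennreal ((1 + norm w) powr - real DIM('a)) \<partial>lborel) < \<infinity>"
proof -
  define n where "n = real DIM('a)"
  let ?near = "\<lambda>w. a w * indicator (ball 0 1) w"
  let ?far = "\<lambda>w. a w * ennreal (dist 0 w powr (1 - n - 1)) * indicator (- ball 0 1) w"
  obtain C where "0 \<le> C" and C: "\<And>(a :: 'a \<Rightarrow> ennreal) A y r.
      \<lbrakk>a \<in> borel_measurable borel; ball_growth (\<lambda>w. (a w)\<^sup>2) A (real DIM('a) - 2); 0 < r\<rbrakk> \<Longrightarrow>
      (\<integral>\<^sup>+w. a w * ennreal (dist y w powr (1 - real DIM('a) - 1)) * indicator (- ball y r) w \<partial>lborel)\<^sup>2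
        \<le> A * ennreal (C * r powr (- 2 * 1))"
    using far_cauchy_schwarz[OF zero_less_one, where 'a='a] by blast
  have "(\<integral>\<^sup>+w. ?far w \<partial>lborel)\<^sup>2 \<le> ennreal A * ennreal (C * 1 powr (- 2 * 1))"
    using C[OF a growth zero_less_one, of 0] unfolding n_def .
  also have "\<dots> < \<infinity>" by (simp add: ennreal_mult_less_top)
  finally have far: "(\<integral>\<^sup>+w. ?far w \<partial>lborel) < \<infinity>" by (simp add: power_less_top_ennreal)
  have "(\<integral>\<^sup>+w. ?near w \<partial>lborel)\<^sup>2 = (\<integral>\<^sup>+w. ?near w * indicator (ball 0 1) w \<partial>lborel)\<^sup>2"
    by (intro arg_cong[where f="\<lambda>x. x\<^sup>2"] nn_integral_cong) (simp split: split_indicator)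
  also have "\<dots> \<le> (\<integral>\<^sup>+w. (?near w)\<^sup>2 \<partial>lborel) * (\<integral>\<^sup>+w. (indicator (ball 0 1) w)\<^sup>2 \<partial>(lborel :: 'a measure))"
    by (rule Cauchy_Schwarz_nn_integral) measurable
  also have "(\<integral>\<^sup>+w. (?near w)\<^sup>2 \<partial>lborel) = (\<integral>\<^sup>+w. (a w)\<^sup>2 * indicator (ball 0 1) w \<partial>lborel)"
    by (intro nn_integral_cong) (simp split: split_indicator)
  also have "(\<integral>\<^sup>+w. (indicator (ball 0 1) w)\<^sup>2 \<partial>(lborel :: 'a measure)) = (\<integral>\<^sup>+w. indicator (ball 0 1) w \<partial>(lborel :: 'a measure))"
    by (intro nn_integral_cong) (simp split: split_indicator)
  also have "(\<integral>\<^sup>+w. (a w)\<^sup>2 * indicator (ball 0 1) w \<partial>lborel) * (\<integral>\<^sup>+w. indicator (ball 0 1) w \<partial>(lborel :: 'a measure)) < \<infinity>"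
  proof -
    have "(\<integral>\<^sup>+w. (a w)\<^sup>2 * indicator (ball 0 1) w \<partial>lborel) \<le> ennreal A * ennreal (1 powr (n - 2))"
      using growth unfolding ball_growth_def n_def by (meson zero_less_one)
    then have "(\<integral>\<^sup>+w. (a w)\<^sup>2 * indicator (ball 0 1) w \<partial>lborel) < \<infinity>"
      by (rule order.strict_trans1) (simp add: ennreal_mult_less_top)
    then show ?thesis by (simp add: ennreal_mult_less_top emeasure_ball)
  qed
  finally have near: "(\<integral>\<^sup>+w. ?near w \<partial>lborel) < \<infinity>" by (simp add: power_less_top_ennreal)
  have "(\<integral>\<^sup>+w. a w * ennreal ((1 + norm w) powr - n) \<partial>lborel) \<le> (\<integral>\<^sup>+w. ?near w + ?far w \<partial>lborel)"
  proof (intro nn_integral_mono)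
    fix w :: 'a
    show "a w * ennreal ((1 + norm w) powr - n) \<le> ?near w + ?far w"
    proof (cases "norm w < 1")
      case True
      have "(1 + norm w) powr - n \<le> 1 powr - n" by (intro powr_mono2') (auto simp: n_def)
      then have "a w * ennreal ((1 + norm w) powr - n) \<le> a w * ennreal 1"
        by (intro mult_left_mono ennreal_leI) auto
      then show ?thesis using True by simp
    next
      case False
      then have "(1 + norm w) powr - n \<le> norm w powr - n" by (intro powr_mono2') (auto simp: n_def)
      then have "a w * ennreal ((1 + norm w) powr - n) \<le> a w * ennreal (norm w powr - n)"
        by (intro mult_left_mono ennreal_leI) auto
      then show ?thesis using False by simp
    qed
  qed
  also have "\<dots> = (\<integral>\<^sup>+w. ?near w \<partial>lborel) + (\<integral>\<^sup>+w. ?far w \<partial>lborel)"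
    by (rule nn_integral_add) measurable
  also have "\<dots> < \<infinity>" using near far by simp
  finally show ?thesis by (simp add: n_def)
qed

lemma schwartz_measurable:
  assumes "\<phi> \<in> schwartz"
  shows "\<phi> \<in> borel_measurable lebesgue"
proof -
  have "\<phi> differentiable (at x)" for x
    using assms by (auto simp: schwartz_def dest!: bspec[of _ _ "[]"])
  then have "continuous_on UNIV \<phi>"
    by (auto simp: continuous_on_eq_continuous_at intro: differentiable_imp_continuous_within)
  then show ?thesis
    by (intro measurable_completion) (simp add: borel_measurable_continuous_onI)
qed

text \<open>The empty list of derivatives is one of the summands of the seminorm, and all summands are nonnegative.\<close>
lemma schwartz_decay:
  fixes \<phi> :: "'a::euclidean_space \<Rightarrow> complex"
  assumes "\<phi> \<in> schwartz"
  shows "(1 + norm x) ^ N * cmod (\<phi> x) \<le> schwartz_norm N \<phi>"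
proof -
  let ?S = "\<lambda>bs. SUP x. (1 + norm x) ^ N * cmod (partials bs \<phi> x)"
  have bdd: "bdd_above (range (\<lambda>x. (1 + norm x) ^ N * cmod (partials bs \<phi> x)))" if "bs \<in> lists Basis" for bs
    using bspec[OF assms[unfolded schwartz_def mem_Collect_eq] that] by simp
  have nonneg: "0 \<le> ?S bs" if "bs \<in> lists Basis" for bs
    using cSUP_upper2[OF bdd[OF that], of 0 0] by simp
  have fin: "finite {bs \<in> lists (Basis :: 'a set). length bs \<le> N}"
    using finite_lists_length_le[of "Basis :: 'a set" N] by (simp add: lists_eq_set conj_commute Collect_conj_eq)
  have "(1 + norm x) ^ N * cmod (\<phi> x) \<le> ?S []"
    using cSUP_upper[OF _ bdd[of "[]"], of x] by simp
  also have "\<dots> \<le> schwartz_norm N \<phi>"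
    unfolding schwartz_norm_def using nonneg by (intro member_le_sum fin) auto
  finally show ?thesis .
qed

text \<open>Here \<open>u\<close> is defined by the integral on all functions. Its values on heat kernels are therefore convolution
  integrals by definition.\<close>
lemma morrey_tempered:
  fixes f :: "'a::euclidean_space \<Rightarrow> complex"
  assumes f: "f \<in> morrey"
  defines "u \<phi> \<equiv> \<integral>x. f x * \<phi> x \<partial>lebesgue"
  shows "u \<in> tempered_distributions" "represented_by u f"
proof -
  obtain a A where a[measurable]: "a \<in> borel_measurable borel" and fa: "AE w in lborel. ennreal (cmod (f w)) = a w"
    and growth: "ball_growth (\<lambda>w. (a w)\<^sup>2) (ennreal A) (real DIM('a) - 2)"
    using morrey_ball_growth[OF f] by blast
  have [measurable]: "f \<in> borel_measurable lebesgue"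
    using f by (auto simp: morrey_def L2_loc_def)
  obtain W where W: "0 \<le> W" "(\<integral>\<^sup>+w. a w * ennreal ((1 + norm w) powr - real DIM('a)) \<partial>lborel) = ennreal W"
    using morrey_integral_weighted_finite[OF a growth]
    by (cases "(\<integral>\<^sup>+w. a w * ennreal ((1 + norm w) powr - real DIM('a)) \<partial>lborel)") auto
  let ?N = "schwartz_norm DIM('a)"
  have Npos: "0 \<le> ?N \<phi>" if "\<phi> \<in> schwartz" for \<phi> :: "'a \<Rightarrow> complex"
    using schwartz_decay[OF that, of 0 "DIM('a)"] by (smt (verit) mult_nonneg_nonneg norm_ge_zero zero_le_power)
  have bound: "(\<integral>\<^sup>+x. ennreal (norm (f x * \<phi> x)) \<partial>lebesgue) \<le> ennreal (W * ?N \<phi>)" if \<phi>: "\<phi> \<in> schwartz" for \<phi>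
  proof -
    have dec: "cmod (\<phi> x) \<le> (1 + norm x) powr - real DIM('a) * ?N \<phi>" for x
      using schwartz_decay[OF \<phi>, of x "DIM('a)"]
      by (simp add: powr_minus powr_realpow add_pos_nonneg field_simps)
    have "(\<integral>\<^sup>+x. ennreal (norm (f x * \<phi> x)) \<partial>lebesgue)
        \<le> (\<integral>\<^sup>+x. a x * ennreal ((1 + norm x) powr - real DIM('a)) * ennreal (?N \<phi>) \<partial>lborel)"
      unfolding nn_integral_completion
    proof (rule nn_integral_mono_AE)
      show "AE x in lborel. ennreal (norm (f x * \<phi> x)) \<le> a x * ennreal ((1 + norm x) powr - real DIM('a)) * ennreal (?N \<phi>)"
        using fa
      proof eventually_elim
        case (elim x)
        have "ennreal (norm (f x * \<phi> x)) = a x * ennreal (cmod (\<phi> x))"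
          by (simp add: norm_mult ennreal_mult elim)
        also have "\<dots> \<le> a x * ennreal ((1 + norm x) powr - real DIM('a) * ?N \<phi>)"
          by (intro mult_left_mono ennreal_leI dec) simp
        finally show ?case using Npos[OF \<phi>] by (simp add: ennreal_mult mult.assoc)
      qed
    qed
    also have "\<dots> = ennreal W * ennreal (?N \<phi>)"
      unfolding W(2)[symmetric] by (rule nn_integral_multc) measurable
    finally show ?thesis using W(1) Npos[OF \<phi>] by (simp add: ennreal_mult)
  qed
  have int: "integrable lebesgue (\<lambda>x. f x * \<phi> x)" if \<phi>: "\<phi> \<in> schwartz" for \<phi>
  proof (rule integrableI_bounded)
    show "(\<lambda>x. f x * \<phi> x) \<in> borel_measurable lebesgue"
      using schwartz_measurable[OF \<phi>] by measurable
    show "(\<integral>\<^sup>+x. ennreal (norm (f x * \<phi> x)) \<partial>lebesgue) < \<infinity>"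
      using bound[OF \<phi>] by (rule order.strict_trans1) simp
  qed
  show "represented_by u f" by (simp add: represented_by_def u_def int)
  have "cmod (u \<phi>) \<le> W * ?N \<phi>" if \<phi>: "\<phi> \<in> schwartz" for \<phi>
  proof -
    have "ennreal (cmod (u \<phi>)) \<le> ennreal (W * ?N \<phi>)"
      unfolding u_def using norm_integral_le_nn_integral bound[OF \<phi>] by (rule order_trans)
    then show ?thesis using W(1) Npos[OF \<phi>] by simp
  qed
  moreover have "u (\<lambda>x. \<phi> x + \<psi> x) = u \<phi> + u \<psi>" if "\<phi> \<in> schwartz" "\<psi> \<in> schwartz" for \<phi> \<psi>
    using int[OF that(1)] int[OF that(2)] by (simp add: u_def distrib_left)
  moreover have "u (\<lambda>x. c * \<phi> x) = c * u \<phi>" for c \<phi>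
    by (simp add: u_def mult.left_commute[of _ c])
  ultimately show "u \<in> tempered_distributions"
    unfolding tempered_distributions_def by blast
qed

section \<open>The two inclusions\<close>
theorem theorem3p1:
  shows "(riesz_potential_morrey :: ('a::euclidean_space \<Rightarrow> complex) set)
           \<subseteq> (\<Inter>\<alpha>\<in>{0<..<1}. Q_space \<alpha>)
       \<and> (morrey :: ('a \<Rightarrow> complex) set)
           \<subseteq> {f. \<exists>u \<in> (\<Inter>\<alpha>\<in>{0<..<1}. Q_inv \<alpha>). represented_by u f}"
proof (intro conjI subsetI)
  fix f :: "'a \<Rightarrow> complex" assume "f \<in> riesz_potential_morrey"
  then show "f \<in> (\<Inter>\<alpha>\<in>{0<..<1}. Q_space \<alpha>)"
    by (auto intro: riesz_potential_in_Q_space)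
next
  fix f :: "'a \<Rightarrow> complex" assume f: "f \<in> morrey"
  let ?u = "\<lambda>\<phi>. \<integral>x. f x * \<phi> x \<partial>lebesgue"
  have "?u \<in> Q_inv \<alpha>" if "\<alpha> \<in> {0<..<1}" for \<alpha>
    using morrey_tempered(1)[OF f] Q_inv_norm_finite[OF f, of \<alpha> ?u] that by (simp add: Q_inv_def)
  then show "f \<in> {f. \<exists>u \<in> (\<Inter>\<alpha>\<in>{0<..<1}. Q_inv \<alpha>). represented_by u f}"
    using morrey_tempered(2)[OF f] by blast
qed

end
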